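(* Let $H$ be a strongly planar hamburger graph with hamburger matrix $M_H$, and let $c^+$ be the number of positive cycle systems in $H$. Then $\det M_H = c^+$.
   Context: All graphs are finite and directed. A hamburger graph $H$ consists of two vertex-disjoint acyclic directed graphs $G_1=(V_1,E_1)$ and $G_2=(V_2,E_2)$ and a connecting edge set $E_3$, as follows. $G_1$ has $k$ distinguished vertices $v_1,\dots,v_k$ such that there is a (nontrivial) directed path in $G_1$ from $v_i$ to $v_j$ only if $i<j$. $G_2$ has $k$ distinguished vertices $w_{k+1},\dots,w_{2k}$ such that there is a (nontrivial) directed path in $G_2$ from $w_i$ to $w_j$ only if $i>j$. $G_1$ and $G_2$ may have further, non-distinguished vertices. The set $E_3$ consists of exactly the edges $e_i: v_i\to w_{k+i}$ and $e_i': w_{k+i}\to v_i$ for $1\le i\le k$. $H$ is strongly planar if there is a planar embedding of $H$ that sends $v_i$ to $(i,1)$ and $w_{k+i}$ to $(i,-1)$ for all $1\le i\le k$, and keeps the edges of $E_1$ in the half-plane $y\ge 1$ and the edges of $E_2$ in the half-plane $y\le -1$. The hamburger matrix is the block matrix $$M_H=\begin{bmatrix} A & I_k\\ -I_k & B\end{bmatrix},$$ where $A=(a_{ij})$ is the $k\times k$ matrix with $a_{ij}$ the number of directed paths from $v_i$ to $v_j$ in $G_1$, and $B=(b_{ij})$ is the $k\times k$ matrix with $b_{ij}$ the number of directed paths from $w_{k+i}$ to $w_{k+j}$ in $G_2$. The trivial (length $0$) path is counted, so $a_{ii}=b_{ii}=1$. A cycle system $\mathcal C$ in $H$ is a (possibly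 empty) collection of pairwise vertex-disjoint directed cycles in $H$, where a cycle is a closed directed path with no repeated vertices (the 2-cycles $v_i\to w_{k+i}\to v_i$ are allowed). Let $l$ be the number of edges in $\mathcal C$ going from $G_2$ to $G_1$ and $m$ the number of cycles in $\mathcal C$. The cycle system is positive if $(-1)^{l+m}=+1$ and negative if $(-1)^{l+m}=-1$. *)

theory Defs
  imports
    "HOL-Analysis.Path_Connected"
    "Graph_Theory.Graph_Theory"
    "Jordan_Normal_Form.Determinant"
begin

text \<open>
  Digraphs may have parallel arcs, so paths and cycles are made of arcs.
  The arcs \<open>e i\<close> and \<open>e' i\<close>, for \<open>1 \<le> i \<le> k\<close>, are the connecting edges; only the values of
  \<open>v\<close>, \<open>e\<close>, \<open>e'\<close> on \<open>{1..k}\<close> and of \<open>w\<close> on \<open>{k+1..2*k}\<close> matter.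
\<close>

locale hamburger_graph = fin_digraph H
  for H :: "('a, 'b) pre_digraph" +
  fixes G1 G2 :: "('a, 'b) pre_digraph"
    and k :: nat
    and v w :: "nat \<Rightarrow> 'a"
    and e e' :: "nat \<Rightarrow> 'b"
  assumes subgraphs: "subgraph G1 H" "subgraph G2 H"
    and verts_disjoint: "verts G1 \<inter> verts G2 = {}"
    and verts_H: "verts H = verts G1 \<union> verts G2"
    and arcs_H: "arcs H = arcs G1 \<union> arcs G2 \<union> (e ` {1..k} \<union> e' ` {1..k})"
    and acyclic_G1: "\<nexists>c. pre_digraph.cycle G1 c"
    and acyclic_G2: "\<nexists>c. pre_digraph.cycle G2 c"
    and v_distinct: "inj_on v {1..k}" "v ` {1..k} \<subseteq> verts G1"
    and w_distinct: "inj_on w {k+1..2*k}" "w ` {k+1..2*k} \<subseteq> verts G2"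
    and v_order: "\<And>i j p. \<lbrakk>i \<in> {1..k}; j \<in> {1..k}; pre_digraph.apath G1 (v i) p (v j); p \<noteq> []\<rbrakk>
      \<Longrightarrow> i < j"
    and w_order: "\<And>i j p. \<lbrakk>i \<in> {k+1..2*k}; j \<in> {k+1..2*k};
      pre_digraph.apath G2 (w i) p (w j); p \<noteq> []\<rbrakk> \<Longrightarrow> i > j"
    and e_ends: "\<And>i. i \<in> {1..k} \<Longrightarrow> tail H (e i) = v i \<and> head H (e i) = w (k + i)"
    and e'_ends: "\<And>i. i \<in> {1..k} \<Longrightarrow> tail H (e' i) = w (k + i) \<and> head H (e' i) = v i"

text \<open>Matrix indices start at \<open>0\<close>, hence the shift by \<open>Suc\<close>.\<close>

definition path_count_matrix :: "('a, 'b) pre_digraph \<Rightarrow> nat \<Rightarrow> (nat \<Rightarrow> 'a) \<Rightarrow> int mat" where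
  "path_count_matrix G k x =
    mat k k (\<lambda>(i, j). int (card {p. pre_digraph.apath G (x (Suc i)) p (x (Suc j))}))"

definition hamburger_matrix ::
  "('a, 'b) pre_digraph \<Rightarrow> ('a, 'b) pre_digraph \<Rightarrow> nat \<Rightarrow> (nat \<Rightarrow> 'a) \<Rightarrow> (nat \<Rightarrow> 'a) \<Rightarrow> int mat" where
  "hamburger_matrix G1 G2 k v w =
    four_block_mat (path_count_matrix G1 k v) (1\<^sub>m k)
                   (- 1\<^sub>m k) (path_count_matrix G2 k (\<lambda>i. w (k + i)))"

text \<open>
  A cycle is represented by its set of arcs, so that the rotations of a closed walk count once.
  The vertices of a cycle are then the tails of its arcs.
\<close>

definition cycle_system :: "('a, 'b) pre_digraph \<Rightarrow> 'b set set \<Rightarrow> bool" where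
  "cycle_system H \<C> \<longleftrightarrow>
    (\<forall>C\<in>\<C>. \<exists>c. pre_digraph.cycle H c \<and> C = set c) \<and>
    (\<forall>C\<in>\<C>. \<forall>D\<in>\<C>. C \<noteq> D \<longrightarrow> tail H ` C \<inter> tail H ` D = {})"

definition upward_edge_count ::
  "('a, 'b) pre_digraph \<Rightarrow> ('a, 'b) pre_digraph \<Rightarrow> ('a, 'b) pre_digraph \<Rightarrow> 'b set set \<Rightarrow> nat" where
  "upward_edge_count H G1 G2 \<C> = card {a \<in> \<Union>\<C>. tail H a \<in> verts G2 \<and> head H a \<in> verts G1}"

definition positive_cycle_system ::
  "('a, 'b) pre_digraph \<Rightarrow> ('a, 'b) pre_digraph \<Rightarrow> ('a, 'b) pre_digraph \<Rightarrow> 'b set set \<Rightarrow> bool" where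
  "positive_cycle_system H G1 G2 \<C> \<longleftrightarrow>
    cycle_system H \<C> \<and> (- 1 :: int) ^ (upward_edge_count H G1 G2 \<C> + card \<C>) = 1"

text \<open>
  An embedding places the vertices at distinct points of the plane and draws every arc as a
  simple curve between its ends; a drawn arc meets vertices only at its ends, and two drawn arcs
  meet only at common ends.
\<close>

definition planar_embedding ::
  "('a, 'b) pre_digraph \<Rightarrow> ('a \<Rightarrow> real \<times> real) \<Rightarrow> ('b \<Rightarrow> real \<Rightarrow> real \<times> real) \<Rightarrow> bool" where
  "planar_embedding G pos \<gamma> \<longleftrightarrow>
    inj_on pos (verts G) \<and>
    (\<forall>a\<in>arcs G. simple_path (\<gamma> a) \<and>
      pathstart (\<gamma> a) = pos (tail G a) \<and> pathfinish (\<gamma> a) = pos (head G a)) \<and>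
    (\<forall>a\<in>arcs G. \<forall>x\<in>verts G. pos x \<in> path_image (\<gamma> a) \<longrightarrow> x \<in> {tail G a, head G a}) \<and>
    (\<forall>a\<in>arcs G. \<forall>b\<in>arcs G. a \<noteq> b \<longrightarrow>
      path_image (\<gamma> a) \<inter> path_image (\<gamma> b) \<subseteq> pos ` ({tail G a, head G a} \<inter> {tail G b, head G b}))"

definition strongly_planar ::
  "('a, 'b) pre_digraph \<Rightarrow> ('a, 'b) pre_digraph \<Rightarrow> ('a, 'b) pre_digraph \<Rightarrow>
    nat \<Rightarrow> (nat \<Rightarrow> 'a) \<Rightarrow> (nat \<Rightarrow> 'a) \<Rightarrow> bool" where
  "strongly_planar H G1 G2 k v w \<longleftrightarrow>
    (\<exists>pos \<gamma>. planar_embedding H pos \<gamma> \<and>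
      (\<forall>i\<in>{1..k}. pos (v i) = (real i, 1) \<and> pos (w (k + i)) = (real i, - 1)) \<and>
      (\<forall>a\<in>arcs G1. path_image (\<gamma> a) \<subseteq> {z. snd z \<ge> 1}) \<and>
      (\<forall>a\<in>arcs G2. path_image (\<gamma> a) \<subseteq> {z. snd z \<le> - 1}))"

end

(*
  Expanding det(I - X) for a weighted adjacency matrix X over permutations gives the sum over
  cycle systems of (-1)^(number of cycles) times their weight. Give the upward edges weight -1
  and all others weight 1: the sum becomes that of (-1)^(l+m). On the other side, I - N is
  inverted by the path counts of an acyclic graph and has determinant 1, so a Schur complement
  reduces det(I - X) to det(I + AB) = det M_H. Hence det M_H = c^+ - c^- for every hamburger graph.

  In the strongly planar case every cycle has exactly one upward edge, so l = m and no cycle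
  system is negative. Indeed the pieces of a cycle in the upper half plane match the points where
  it comes up with the points where it goes down, always from left to right and, by the
  Fashoda meet theorem, without crossings; so do the pieces in the lower half plane, read backwards.
  A noncrossing matching is determined by its sets of left and right ends, hence both matchings
  agree and the cycle closes after one piece on each side.
*)
theory Submission
  imports Defs "HOL-Combinatorics.Cycles" "HOL-Analysis.Fashoda_Theorem"
begin

section \<open>Determinants and cycle systems\<close>

text \<open>Circulations mediate between permutations and cycle systems. Such an arc set amounts to
  a permutation with one chosen arc for each moved vertex, which is what parallel arcs demand, and
  it is also the union of exactly one family of disjoint cycles. Tail and head are arbitrary
  functions, so that vertices can be renamed to natural numbers for the determinant. The Schur
  complement alone gives a determinant as large as the second graph; Sylvester's identity det(I +
  BC) = det(I + CB) shrinks it to size k, where only distinguished vertices remain. In the planar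
  part a crossing of curves is not yet a contradiction. It must become a shared vertex, as drawn
  arcs meet only at common ends, and then an equality of pieces: heads are injective on a cycle, so
  tracing back from the shared vertex leads to a single entrance. A further obstacle is that one
  index can be both a left and a right end, when a cycle uses both connecting edges there. The piece
  is then trivial, and the uniqueness of matchings needs this as an extra condition.\<close>

definition closed_cycle :: "('b \<Rightarrow> 'a) \<Rightarrow> ('b \<Rightarrow> 'a) \<Rightarrow> 'b list \<Rightarrow> bool" where
  "closed_cycle t h c \<longleftrightarrow> c \<noteq> [] \<and> distinct (map t c) \<and> map h c = rotate1 (map t c)"

definition cycle_family :: "('b \<Rightarrow> 'a) \<Rightarrow> ('b \<Rightarrow> 'a) \<Rightarrow> 'b set \<Rightarrow> 'b set set \<Rightarrow> bool" where
  "cycle_family t h A \<C> \<longleftrightarrow>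
    (\<forall>C\<in>\<C>. C \<subseteq> A \<and> (\<exists>c. closed_cycle t h c \<and> C = set c)) \<and>
    (\<forall>C\<in>\<C>. \<forall>D\<in>\<C>. C \<noteq> D \<longrightarrow> t ` C \<inter> t ` D = {})"

text \<open>A vertex-disjoint union of cycles described without naming the cycles: every vertex
  touched is left by exactly one arc and entered by exactly one.\<close>

definition circulation :: "('b \<Rightarrow> 'a) \<Rightarrow> ('b \<Rightarrow> 'a) \<Rightarrow> 'b set \<Rightarrow> bool" where
  "circulation t h S \<longleftrightarrow> finite S \<and> inj_on t S \<and> inj_on h S \<and> t ` S = h ` S"

text \<open>Vertices off the arc set become fixed points; in the Leibniz formula they account for
  the diagonal factors 1.\<close>

definition arc_perm :: "('b \<Rightarrow> 'a) \<Rightarrow> ('b \<Rightarrow> 'a) \<Rightarrow> 'b set \<Rightarrow> 'a \<Rightarrow> 'a" where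
  "arc_perm t h S x = (if x \<in> t ` S then h (the_inv_into S t x) else x)"

lemma arc_perm_tail: "inj_on t S \<Longrightarrow> a \<in> S \<Longrightarrow> arc_perm t h S (t a) = h a"
  by (simp add: arc_perm_def the_inv_into_f_f)

lemma arc_perm_outside: "x \<notin> t ` S \<Longrightarrow> arc_perm t h S x = x"
  by (simp add: arc_perm_def)

lemma arc_perm_permutes:
  assumes "circulation t h S"
  shows "arc_perm t h S permutes t ` S"
proof (rule bij_imp_permutes)
  have tail: "arc_perm t h S (t a) = h a" if "a \<in> S" for a
    using assms that by (simp add: circulation_def arc_perm_tail)
  have "inj_on (arc_perm t h S) (t ` S)"
  proof (rule inj_onI)
    fix x y assume "x \<in> t ` S" "y \<in> t ` S" and eq: "arc_perm t h S x = arc_perm t h S y"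
    then obtain a b where ab: "a \<in> S" "b \<in> S" "x = t a" "y = t b" by blast
    then have "h a = h b" using eq tail by simp
    then show "x = y" using assms ab by (auto simp: circulation_def dest: inj_onD)
  qed
  moreover have "arc_perm t h S ` (t ` S) = t ` S"
  proof -
    have "arc_perm t h S ` (t ` S) = h ` S"
      unfolding image_image using tail by (intro image_cong) auto
    then show ?thesis using assms by (simp add: circulation_def)
  qed
  ultimately show "bij_betw (arc_perm t h S) (t ` S) (t ` S)"
    by (simp add: bij_betw_def)
qed (simp add: arc_perm_outside)

lemma permutation_arc_perm: "circulation t h S \<Longrightarrow> permutation (arc_perm t h S)"
  using arc_perm_permutes permutation_permutes by (metis circulation_def finite_imageI)

lemma closed_cycle_circulation:
  assumes "closed_cycle t h c"
  shows "circulation t h (set c)"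
proof -
  have "distinct (map h c)" using assms by (simp add: closed_cycle_def)
  moreover have "set (map h c) = set (map t c)" using assms by (simp add: closed_cycle_def)
  ultimately show ?thesis using assms
    by (auto simp: circulation_def closed_cycle_def distinct_map)
qed

lemma arc_perm_closed_cycle:
  assumes "closed_cycle t h c"
  shows "arc_perm t h (set c) = cycle_of_list (map t c)"
proof
  fix x
  have circ: "circulation t h (set c)" using assms by (rule closed_cycle_circulation)
  have d: "distinct (map t c)" using assms by (simp add: closed_cycle_def)
  have "map (cycle_of_list (map t c)) (map t c) = map h c"
    using cyclic_rotation[OF d, of 1] assms by (simp add: closed_cycle_def)
  then have "cycle_of_list (map t c) (t a) = h a" if "a \<in> set c" for a
    using that by simp
  moreover have "arc_perm t h (set c) (t a) = h a" if "a \<in> set c" for a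
    using circ that by (simp add: circulation_def arc_perm_tail)
  ultimately have "arc_perm t h (set c) x = cycle_of_list (map t c) x" if "x \<in> t ` set c"
    using that by auto
  then show "arc_perm t h (set c) x = cycle_of_list (map t c) x"
    using id_outside_supp[of x "map t c"] arc_perm_outside[of x t] by fastforce
qed

text \<open>A cycle of length n is a product of n - 1 transpositions; n + 1 has the same parity and
  avoids subtraction on \<open>nat\<close>. For the empty list the formula would give the wrong
  sign.\<close>

lemma sign_cycle_of_list:
  assumes "distinct cs" "cs \<noteq> []"
  shows "sign (cycle_of_list cs) = (- 1) ^ Suc (length cs)"
  using assms
proof (induction cs rule: cycle_of_list.induct)
  case (1 i j cs)
  have "sign (cycle_of_list (i # j # cs)) = sign (Transposition.transpose i j) * sign (cycle_of_list (j # cs))"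
    by (simp only: cycle_of_list.simps sign_compose permutation_swap_id permutation_of_cycle)
  then show ?case using 1 by (simp add: sign_swap_id del: cycle_of_list.simps)
qed auto

lemma sign_arc_perm_closed_cycle:
  assumes "closed_cycle t h c"
  shows "sign (arc_perm t h (set c)) = (- 1) ^ Suc (card (set c))"
proof -
  have "distinct c" "distinct (map t c)" "map t c \<noteq> []"
    using assms by (auto simp: closed_cycle_def distinct_map)
  then show ?thesis
    by (simp add: arc_perm_closed_cycle[OF assms] sign_cycle_of_list distinct_card)
qed

lemma circulation_Un:
  assumes "circulation t h S" "circulation t h T" "t ` S \<inter> t ` T = {}"
  shows "circulation t h (S \<union> T)"
proof -
  have "t ` (S - T) \<inter> t ` (T - S) = {}" "h ` (S - T) \<inter> h ` (T - S) = {}"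
    using assms unfolding circulation_def by blast+
  then show ?thesis
    using assms unfolding circulation_def inj_on_Un by (simp add: image_Un)
qed

lemma circulation_Diff:
  assumes "circulation t h S" "circulation t h T" "T \<subseteq> S"
  shows "circulation t h (S - T)"
  using assms unfolding circulation_def
  by (auto simp: inj_on_diff inj_on_image_set_diff[of t S S T] inj_on_image_set_diff[of h S S T])

lemma arc_perm_Un:
  assumes "circulation t h S" "circulation t h T" "t ` S \<inter> t ` T = {}"
  shows "arc_perm t h (S \<union> T) = arc_perm t h S \<circ> arc_perm t h T"
proof
  fix x
  have inj: "inj_on t (S \<union> T)"
    using circulation_Un[OF assms] by (simp add: circulation_def)
  consider a where "a \<in> S" "x = t a" | a where "a \<in> T" "x = t a" | "x \<notin> t ` S" "x \<notin> t ` T"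
    by blast
  then show "arc_perm t h (S \<union> T) x = (arc_perm t h S \<circ> arc_perm t h T) x"
  proof cases
    case 1
    then have "x \<notin> t ` T" using assms by blast
    then show ?thesis using 1 assms inj
      by (simp add: arc_perm_tail arc_perm_outside circulation_def)
  next
    case 2
    then have "h a \<in> t ` T" using assms by (auto simp: circulation_def)
    then have "h a \<notin> t ` S" using assms by blast
    then show ?thesis using 2 assms inj
      by (simp add: arc_perm_tail arc_perm_outside circulation_def)
  qed (simp add: arc_perm_outside image_Un)
qed

text \<open>Signs multiply over disjoint cycles, and a cycle of n arcs contributes n + 1 to the
  exponent: n for its arcs and 1 for itself.\<close>

lemma cycle_family_Union:
  assumes "finite \<C>" "cycle_family t h A \<C>"
  shows "circulation t h (\<Union>\<C>) \<and>
    sign (arc_perm t h (\<Union>\<C>)) = (- 1) ^ (card (\<Union>\<C>) + card \<C>)"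
  using assms
proof (induction \<C>)
  case empty
  have "arc_perm t h {} = id" by (auto simp: arc_perm_outside)
  then show ?case by (simp add: circulation_def)
next
  case (insert C \<C>)
  have fam: "cycle_family t h A \<C>"
    using insert.prems by (simp add: cycle_family_def)
  obtain c where c: "closed_cycle t h c" "C = set c"
    using insert.prems by (auto simp: cycle_family_def)
  have circ: "circulation t h (\<Union>\<C>)"
    and IH: "sign (arc_perm t h (\<Union>\<C>)) = (- 1) ^ (card (\<Union>\<C>) + card \<C>)"
    using insert.IH fam by auto
  have circ_C: "circulation t h C"
    using c closed_cycle_circulation by blast
  have "t ` C \<inter> t ` D = {}" if "D \<in> \<C>" for D
  proof -
    have "\<forall>D\<in>\<C>. C \<noteq> D \<longrightarrow> t ` C \<inter> t ` D = {}"
      using insert.prems by (simp add: cycle_family_def)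
    then show ?thesis using that insert.hyps by metis
  qed
  then have disj: "t ` C \<inter> t ` (\<Union>\<C>) = {}" by blast
  then have "card (C \<union> \<Union>\<C>) = card C + card (\<Union>\<C>)"
    using circ circ_C by (intro card_Un_disjoint) (auto simp: circulation_def)
  moreover have "sign (arc_perm t h (C \<union> \<Union>\<C>)) =
      sign (arc_perm t h C) * sign (arc_perm t h (\<Union>\<C>))"
    using arc_perm_Un[OF circ_C circ disj] sign_compose permutation_arc_perm circ circ_C by metis
  ultimately show ?case
    using IH sign_arc_perm_closed_cycle[OF c(1)] c(2) insert.hyps circulation_Un[OF circ_C circ disj]
    by (simp add: power_add)
qed

section \<open>Correspondence between cycle families and circulations\<close>

text \<open>Following the cycle from a common arc never leaves \<open>S\<close>: the next vertex is
  the tail of an arc of \<open>S\<close>, and injectivity of \<open>t\<close> on the union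
  identifies that arc with the next arc of the cycle.\<close>

lemma closed_cycle_subset:
  assumes c: "closed_cycle t h c" and inj: "inj_on t (S \<union> set c)"
    and closed: "h ` S \<subseteq> t ` S" and meet: "S \<inter> set c \<noteq> {}"
  shows "set c \<subseteq> S"
proof -
  let ?n = "length c"
  obtain i where i: "i < ?n" "c ! i \<in> S"
    using meet by (auto simp: in_set_conv_nth)
  have succ: "h (c ! j) = t (c ! (Suc j mod ?n))" if "j < ?n" for j
  proof -
    have "h (c ! j) = rotate1 (map t c) ! j"
      using c that by (metis closed_cycle_def nth_map)
    moreover have "Suc j mod ?n < ?n" using that by (intro mod_less_divisor) auto
    ultimately show ?thesis using that by (simp add: nth_rotate1)
  qed
  have step: "c ! ((i + m) mod ?n) \<in> S" for m
  proof (induction m)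
    case 0
    then show ?case using i by simp
  next
    case (Suc m)
    let ?j = "(i + m) mod ?n"
    have lt: "?j < ?n" using i by (intro mod_less_divisor) auto
    have "h (c ! ?j) \<in> t ` S" using closed Suc by blast
    then obtain b where b: "b \<in> S" "t b = t (c ! (Suc ?j mod ?n))"
      using succ[OF lt] by force
    have "c ! (Suc ?j mod ?n) \<in> set c" using i by (intro nth_mem mod_less_divisor) auto
    then have "b = c ! (Suc ?j mod ?n)" using inj b unfolding inj_on_def by blast
    then show ?case using b by (simp add: mod_Suc_eq)
  qed
  show ?thesis
  proof
    fix a assume "a \<in> set c"
    then obtain j where j: "j < ?n" "a = c ! j" by (auto simp: in_set_conv_nth)
    \<comment> \<open>Going once around first keeps the number of steps from \<open>i\<close> to
      \<open>j\<close> a natural number even when \<open>j < i\<close>.\<close>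
    have "(i + (?n - i + j)) mod ?n = j" using i j by simp
    then show "a \<in> S" using step[of "?n - i + j"] j by simp
  qed
qed

lemma closed_cycle_eq:
  assumes "closed_cycle t h c" "closed_cycle t h d" "inj_on t (set c \<union> set d)"
    "set c \<inter> set d \<noteq> {}"
  shows "set c = set d"
proof (rule antisym)
  show "set c \<subseteq> set d"
    using closed_cycle_subset[OF assms(1), of "set d"] closed_cycle_circulation[OF assms(2)] assms
    by (simp add: circulation_def Un_commute Int_commute)
  show "set d \<subseteq> set c"
    using closed_cycle_subset[OF assms(2), of "set c"] closed_cycle_circulation[OF assms(1)] assms
    by (simp add: circulation_def)
qed

text \<open>Each cycle of one family shares an arc with a cycle of the other, and cycles sharing an
  arc coincide when \<open>t\<close> is injective on all arcs involved.\<close>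

lemma cycle_family_inj:
  assumes "cycle_family t h A \<C>" "cycle_family t h A \<D>" "inj_on t (\<Union>\<C>)" "\<Union>\<C> = \<Union>\<D>"
  shows "\<C> \<subseteq> \<D>"
proof
  fix C assume C: "C \<in> \<C>"
  then obtain c where c: "closed_cycle t h c" "C = set c"
    using assms(1) by (auto simp: cycle_family_def)
  then have "hd c \<in> C" by (simp add: closed_cycle_def)
  then obtain D where D: "D \<in> \<D>" "hd c \<in> D" using C assms(4) by blast
  then obtain d where d: "closed_cycle t h d" "D = set d"
    using assms(2) by (auto simp: cycle_family_def)
  have "C \<union> D \<subseteq> \<Union>\<C>" using C D assms(4) by blast
  then have "inj_on t (set c \<union> set d)"
    using inj_on_subset[OF assms(3)] c d by blast
  then have "C = D" using closed_cycle_eq[OF c(1) d(1)] c d D \<open>hd c \<in> C\<close> by blast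
  then show "C \<in> \<D>" using D by simp
qed

lemma circulation_contains_cycle:
  assumes S: "circulation t h S" and ne: "S \<noteq> {}"
  shows "\<exists>c. closed_cycle t h c \<and> set c \<subseteq> S"
proof -
  let ?p = "arc_perm t h S"
  have inj: "inj_on t S" using S by (simp add: circulation_def)
  obtain a where a: "a \<in> S" using ne by blast
  have perm: "permutation ?p" using S by (rule permutation_arc_perm)
  \<comment> \<open>The length of the orbit of \<open>t a\<close> under the permutation; minimality
    makes the vertices listed below distinct.\<close>
  define n where "n = least_power ?p (t a)"
  have n: "(?p ^^ n) (t a) = t a" "n > 0"
    using least_power_of_permutation[OF perm] unfolding n_def by auto
  let ?cs = "map (\<lambda>i. (?p ^^ i) (t a)) [0..<n]"
  have dist: "distinct ?cs"
    using cycle_of_permutation[OF perm, of "t a"] unfolding n_def .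
  have in_tS: "(?p ^^ i) (t a) \<in> t ` S" for i
    by (induction i) (use a permutes_in_image[OF arc_perm_permutes[OF S]] in auto)
  define c where "c = map (the_inv_into S t) ?cs"
  have tc: "map t c = ?cs"
    using in_tS by (auto simp: c_def f_the_inv_into_f[OF inj])
  have "set c \<subseteq> S"
    using in_tS by (auto simp: c_def intro!: the_inv_into_into[OF inj])
  moreover have "map h c = map ?p ?cs"
    using in_tS by (auto simp: c_def arc_perm_def)
  moreover have "map ?p ?cs = rotate1 ?cs"
  proof (rule nth_equalityI)
    fix i assume "i < length (map ?p ?cs)"
    then have i: "i < n" by simp
    show "map ?p ?cs ! i = rotate1 ?cs ! i"
      using i n by (cases "Suc i = n") (auto simp: nth_rotate1)
  qed simp
  moreover have "c \<noteq> []" using n by (simp add: c_def)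
  ultimately have "closed_cycle t h c \<and> set c \<subseteq> S"
    using dist unfolding closed_cycle_def tc by simp
  then show ?thesis by blast
qed

text \<open>Removing one cycle deletes the same vertices from the tails as from the heads, so the
  rest is a smaller circulation.\<close>

lemma circulation_decomposition:
  assumes "circulation t h S"
  shows "\<exists>\<C>. cycle_family t h S \<C> \<and> \<Union>\<C> = S"
  using assms
proof (induction "card S" arbitrary: S rule: less_induct)
  case less
  show ?case
  proof (cases "S = {}")
    case True
    then show ?thesis by (intro exI[of _ "{}"]) (simp add: cycle_family_def)
  next
    case False
    obtain c where c: "closed_cycle t h c" "set c \<subseteq> S"
      using circulation_contains_cycle[OF less.prems False] by blast
    let ?T = "S - set c"
    have "hd c \<in> set c" using c by (simp add: closed_cycle_def)
    then have "?T \<subset> S" using c by blast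
    then have "card ?T < card S"
      using less.prems by (intro psubset_card_mono) (auto simp: circulation_def)
    moreover have "circulation t h ?T"
      using circulation_Diff[OF less.prems closed_cycle_circulation[OF c(1)] c(2)] .
    ultimately obtain \<C> where \<C>: "cycle_family t h ?T \<C>" "\<Union>\<C> = ?T"
      using less.hyps[of ?T] by auto
    have inj: "inj_on t S" using less.prems by (simp add: circulation_def)
    have "t ` set c \<inter> t ` D = {}" if "D \<in> \<C>" for D
    proof -
      have "D \<subseteq> ?T" using that \<C> by blast
      then have "D \<subseteq> S" "set c \<inter> D = {}" by auto
      then show ?thesis using inj_on_image_Int[OF inj c(2), of D] by simp
    qed
    moreover have "\<forall>C\<in>\<C>. C \<subseteq> S" using \<C> by blast
    ultimately have "cycle_family t h S (insert (set c) \<C>)"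
      using \<C>(1) c unfolding cycle_family_def by (simp add: Int_commute) (metis Int_commute)
    moreover have "\<Union>(insert (set c) \<C>) = S" using \<C> c by auto
    ultimately show ?thesis by blast
  qed
qed

section \<open>The Leibniz formula as a sum over arc sets\<close>

text \<open>Without loops a fixed point of a permutation \<open>p\<close> contributes the factor 1,
  and a moved point \<open>i\<close> contributes minus the total weight of the parallel arcs from
  \<open>i\<close> to \<open>p i\<close>. Multiplying out chooses one arc for each moved point; over
  all \<open>p\<close> these choices are exactly the circulations.\<close>

lemma det_circulations:
  fixes \<omega> :: "'b \<Rightarrow> int" and t h :: "'b \<Rightarrow> nat"
  assumes A: "finite A" "\<And>a. a \<in> A \<Longrightarrow> t a < n" "\<And>a. a \<in> A \<Longrightarrow> h a < n"
    "\<And>a. a \<in> A \<Longrightarrow> t a \<noteq> h a"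
  shows "Determinant.det (mat n n (\<lambda>(i, j). of_bool (i = j) - (\<Sum>a | a \<in> A \<and> t a = i \<and> h a = j. \<omega> a)))
    = (\<Sum>S | S \<subseteq> A \<and> circulation t h S. sign (arc_perm t h S) * (\<Prod>a\<in>S. - \<omega> a))"
proof -
  let ?M = "mat n n (\<lambda>(i, j). of_bool (i = j) - (\<Sum>a | a \<in> A \<and> t a = i \<and> h a = j. \<omega> a))"
  let ?P = "{p. p permutes {0..<n}}"
  let ?X = "{S. S \<subseteq> A \<and> circulation t h S}"
  have expand: "(\<Prod>i = 0..<n. ?M $$ (i, p i)) =
      (\<Sum>S | S \<in> ?X \<and> arc_perm t h S = p. \<Prod>a\<in>S. - \<omega> a)" if p: "p \<in> ?P" for p
  proof -
    let ?I = "{i\<in>{0..<n}. p i \<noteq> i}"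
    let ?B = "\<lambda>i. {a\<in>A. t a = i \<and> h a = p i}"
    have pn: "p i < n" if "i < n" for i
      using p that permutes_in_image[of p "{0..<n}" i] by simp
    have "(\<Prod>i = 0..<n. ?M $$ (i, p i)) = (\<Prod>i = 0..<n. of_bool (i = p i) - sum \<omega> (?B i))"
      using pn by (intro prod.cong) auto
    also have "\<dots> = (\<Prod>i\<in>?I. \<Sum>a\<in>?B i. - \<omega> a)"
    proof (rule prod.mono_neutral_cong_right)
      show "\<forall>i\<in>{0..<n} - ?I. of_bool (i = p i) - sum \<omega> (?B i) = 1"
      proof
        fix i assume "i \<in> {0..<n} - ?I"
        then have "p i = i" by auto
        have "?B i = {}" using \<open>p i = i\<close> A(4) by force
        then have "sum \<omega> (?B i) = 0" by (simp only: sum.empty)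
        then show "of_bool (i = p i) - sum \<omega> (?B i) = 1" using \<open>p i = i\<close> by simp
      qed
    qed (auto simp: sum_negf)
    also have "\<dots> = (\<Sum>f\<in>PiE ?I ?B. \<Prod>i\<in>?I. - \<omega> (f i))"
      using A(1) by (intro prod_sum_PiE) auto
    also have "\<dots> = (\<Sum>S | S \<in> ?X \<and> arc_perm t h S = p. \<Prod>a\<in>S. - \<omega> a)"
    \<comment> \<open>A choice function is exchanged for its image; inverting the tail map on the
      arc set recovers the choice.\<close>
    proof (rule sum.reindex_bij_witness[where i = "\<lambda>S. \<lambda>i\<in>?I. the_inv_into S t i" and j = "\<lambda>f. f ` ?I"])
      fix f assume f: "f \<in> PiE ?I ?B"
      have fi: "f i \<in> A" "t (f i) = i" "h (f i) = p i" if "i \<in> ?I" for i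
        using f that by (auto simp: PiE_iff)
      have injf: "inj_on f ?I" using fi by (metis (no_types, lifting) inj_onI)
      have tS: "t ` f ` ?I = ?I" using fi by (force simp: image_image)
      have pI: "p ` ?I = ?I"
      proof -
        have "inj p" using p permutes_inj by blast
        then have "p ` ?I \<subseteq> ?I" using pn by (auto dest: injD)
        moreover have "finite ?I" by simp
        ultimately show ?thesis
          using \<open>inj p\<close> by (meson endo_inj_surj inj_on_subset subset_UNIV)
      qed
      have "h ` f ` ?I = p ` ?I" unfolding image_image using fi by (intro image_cong) auto
      moreover have "inj_on t (f ` ?I)" using fi by (auto intro!: inj_onI)
      moreover have "inj_on h (f ` ?I)"
      proof (rule inj_onI)
        fix x y assume "x \<in> f ` ?I" "y \<in> f ` ?I" "h x = h y"
        then obtain i j where ij: "i \<in> ?I" "j \<in> ?I" "x = f i" "y = f j" "p i = p j"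
          using fi by auto
        then show "x = y" using p permutes_inj by (metis injD mem_Collect_eq)
      qed
      ultimately have circ: "circulation t h (f ` ?I)"
        using tS pI by (simp add: circulation_def)
      have "arc_perm t h (f ` ?I) = p"
      proof
        fix x
        show "arc_perm t h (f ` ?I) x = p x"
        proof (cases "x \<in> ?I")
          case True
          then show ?thesis
            using arc_perm_tail[of t "f ` ?I" "f x" h] circ fi by (simp add: circulation_def)
        next
          case False
          moreover have "p x = x" if "x \<notin> {0..<n}" using p that by (simp add: permutes_def)
          ultimately have "p x = x" by blast
          have "x \<notin> t ` f ` ?I" using False unfolding tS .
          then have "arc_perm t h (f ` ?I) x = x" by (rule arc_perm_outside)
          then show ?thesis using \<open>p x = x\<close> by (rule trans[OF _ sym])
        qed
      qed
      then show "f ` ?I \<in> {S. S \<in> ?X \<and> arc_perm t h S = p}"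
        using circ fi(1) by auto
      show "(\<lambda>i\<in>?I. the_inv_into (f ` ?I) t i) = f"
      proof
        fix i
        have "the_inv_into (f ` ?I) t (t (f i)) = f i" if "i \<in> ?I"
          using circ that by (intro the_inv_into_f_f) (auto simp: circulation_def)
        then show "(\<lambda>i\<in>?I. the_inv_into (f ` ?I) t i) i = f i"
          using f fi by (auto simp: PiE_iff extensional_def)
      qed
      show "(\<Prod>a\<in>f ` ?I. - \<omega> a) = (\<Prod>i\<in>?I. - \<omega> (f i))"
        using injf by (simp add: prod.reindex)
    next
      fix S assume S: "S \<in> {S. S \<in> ?X \<and> arc_perm t h S = p}"
      then have inj: "inj_on t S" and SA: "S \<subseteq> A" and ps: "arc_perm t h S = p"
        by (auto simp: circulation_def)
      have p_ne: "p (t a) = h a" "t a \<in> ?I" if "a \<in> S" for a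
      proof -
        show *: "p (t a) = h a" using that inj arc_perm_tail ps by metis
        have "a \<in> A" using that SA by blast
        then show "t a \<in> ?I" using A(2,4)[of a] * by auto
      qed
      have tS: "t ` S = ?I"
      proof
        show "?I \<subseteq> t ` S"
        proof
          fix i assume "i \<in> ?I"
          then have "p i \<noteq> i" by simp
          then show "i \<in> t ` S" using arc_perm_outside[of i t S h] ps by blast
        qed
      qed (use p_ne in blast)
      have inv: "the_inv_into S t (t a) = a" if "a \<in> S" for a
        using that inj by (rule the_inv_into_f_f[rotated])
      have "(\<lambda>i\<in>?I. the_inv_into S t i) ` ?I = the_inv_into S t ` (t ` S)"
        unfolding tS by (intro image_cong) auto
      also have "\<dots> = S" using inv by (force simp: image_image)
      finally show "(\<lambda>i\<in>?I. the_inv_into S t i) ` ?I = S" .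
      show "(\<lambda>i\<in>?I. the_inv_into S t i) \<in> PiE ?I ?B"
      proof (rule restrict_PiE_iff[THEN iffD2], rule ballI)
        fix i assume "i \<in> ?I"
        then obtain a where "a \<in> S" "i = t a" using tS by blast
        then show "the_inv_into S t i \<in> ?B i" using inv p_ne SA by auto
      qed
    qed
    finally show ?thesis .
  qed
  have finX: "finite ?X" using A(1) by simp
  have perm: "arc_perm t h S \<in> ?P" if "S \<in> ?X" for S
  proof -
    have "t ` S \<subseteq> {0..<n}" using that A(2) by auto
    then show ?thesis using permutes_subset[OF arc_perm_permutes] that by blast
  qed
  have "Determinant.det ?M = (\<Sum>p\<in>?P. sign p * (\<Prod>i = 0..<n. ?M $$ (i, p i)))"
    by (subst det_def'[of _ n]) auto
  also have "\<dots> = (\<Sum>p\<in>?P. \<Sum>S | S \<in> ?X \<and> arc_perm t h S = p. sign (arc_perm t h S) * (\<Prod>a\<in>S. - \<omega> a))"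
    unfolding sum_distrib_left[symmetric]
  proof (intro sum.cong refl)
    fix p assume "p \<in> ?P"
    then show "sign p * (\<Prod>i = 0..<n. ?M $$ (i, p i)) =
      (\<Sum>S | S \<in> ?X \<and> arc_perm t h S = p. sign (arc_perm t h S) * (\<Prod>a\<in>S. - \<omega> a))"
      unfolding expand[OF \<open>p \<in> ?P\<close>] sum_distrib_left by (intro sum.cong) auto
  qed
  also have "\<dots> = (\<Sum>S\<in>?X. sign (arc_perm t h S) * (\<Prod>a\<in>S. - \<omega> a))"
    using perm finX by (intro sum.group) (auto simp: finite_permutations)
  finally show ?thesis .
qed

text \<open>The minus signs of the negated weights cancel the part of the permutation sign that
  counts arcs, so only the number of cycles is left in the exponent.\<close>

lemma det_cycle_families:
  fixes \<omega> :: "'b \<Rightarrow> int" and t h :: "'b \<Rightarrow> nat"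
  assumes A: "finite A" "\<And>a. a \<in> A \<Longrightarrow> t a < n" "\<And>a. a \<in> A \<Longrightarrow> h a < n"
    "\<And>a. a \<in> A \<Longrightarrow> t a \<noteq> h a"
  shows "Determinant.det (mat n n (\<lambda>(i, j). of_bool (i = j) - (\<Sum>a | a \<in> A \<and> t a = i \<and> h a = j. \<omega> a)))
    = (\<Sum>\<C> | cycle_family t h A \<C>. (- 1) ^ card \<C> * (\<Prod>a\<in>\<Union>\<C>. \<omega> a))"
proof -
  have fin: "finite \<C>" "\<Union>\<C> \<subseteq> A" if "cycle_family t h A \<C>" for \<C>
  proof -
    show "\<Union>\<C> \<subseteq> A" using that unfolding cycle_family_def by blast
    then have "\<C> \<subseteq> Pow A" by blast
    then show "finite \<C>" using A(1) by (meson finite_Pow_iff finite_subset)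
  qed
  have bij: "bij_betw Union {\<C>. cycle_family t h A \<C>} {S. S \<subseteq> A \<and> circulation t h S}"
  proof (rule bij_betw_imageI)
    show "inj_on Union {\<C>. cycle_family t h A \<C>}"
    proof (rule inj_onI)
      fix \<C> \<D> assume "\<C> \<in> {\<C>. cycle_family t h A \<C>}" "\<D> \<in> {\<C>. cycle_family t h A \<C>}"
        and eq: "\<Union>\<C> = \<Union>\<D>"
      then have fam: "cycle_family t h A \<C>" "cycle_family t h A \<D>" by auto
      then have "inj_on t (\<Union>\<C>)"
        using cycle_family_Union fin by (metis circulation_def)
      then show "\<C> = \<D>" using cycle_family_inj fam eq by (metis subset_antisym)
    qed
    show "Union ` {\<C>. cycle_family t h A \<C>} = {S. S \<subseteq> A \<and> circulation t h S}"
    proof (intro subset_antisym subsetI)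
      fix S assume "S \<in> Union ` {\<C>. cycle_family t h A \<C>}"
      then obtain \<C> where \<C>: "cycle_family t h A \<C>" "S = \<Union>\<C>" by auto
      then show "S \<in> {S. S \<subseteq> A \<and> circulation t h S}"
        using fin[OF \<C>(1)] cycle_family_Union[OF _ \<C>(1)] by simp
    next
      fix S assume S: "S \<in> {S. S \<subseteq> A \<and> circulation t h S}"
      then obtain \<C> where \<C>: "cycle_family t h S \<C>" "\<Union>\<C> = S"
        using circulation_decomposition[of t h S] by auto
      then have "cycle_family t h A \<C>"
        using S unfolding cycle_family_def by (metis (no_types, lifting) mem_Collect_eq subset_trans)
      then show "S \<in> Union ` {\<C>. cycle_family t h A \<C>}" using \<C> by blast
    qed
  qed
  have "(\<Sum>S | S \<subseteq> A \<and> circulation t h S. sign (arc_perm t h S) * (\<Prod>a\<in>S. - \<omega> a)) =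
      (\<Sum>\<C> | cycle_family t h A \<C>. sign (arc_perm t h (\<Union>\<C>)) * (\<Prod>a\<in>\<Union>\<C>. - \<omega> a))"
    by (rule sum.reindex_bij_betw[OF bij, symmetric])
  also have "\<dots> = (\<Sum>\<C> | cycle_family t h A \<C>. (- 1) ^ card \<C> * (\<Prod>a\<in>\<Union>\<C>. \<omega> a))"
  proof (intro sum.cong refl)
    fix \<C> assume "\<C> \<in> {\<C>. cycle_family t h A \<C>}"
    then have fam: "cycle_family t h A \<C>" by simp
    have "sign (arc_perm t h (\<Union>\<C>)) = (- 1) ^ (card (\<Union>\<C>) + card \<C>)"
      using cycle_family_Union[OF fin(1)[OF fam] fam] by simp
    moreover have "(\<Prod>a\<in>\<Union>\<C>. - \<omega> a) = (- 1) ^ card (\<Union>\<C>) * (\<Prod>a\<in>\<Union>\<C>. \<omega> a)"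
      by (rule prod_uminus)
    moreover have "(- 1 :: int) ^ card (\<Union>\<C>) * (- 1) ^ card (\<Union>\<C>) = 1"
      by (metis power_mult_distrib minus_mult_minus mult_1 power_one)
    ultimately show "sign (arc_perm t h (\<Union>\<C>)) * (\<Prod>a\<in>\<Union>\<C>. - \<omega> a) =
        (- 1) ^ card \<C> * (\<Prod>a\<in>\<Union>\<C>. \<omega> a)"
      by (simp add: power_add mult.assoc mult.left_commute)
  qed
  finally show ?thesis
    using det_circulations[OF A, where \<omega> = \<omega>] by (rule trans[rotated])
qed

section \<open>Block determinant identities\<close>

text \<open>Sylvester's identity. Multiplying the block matrix by the same unitriangular matrix from
  the right or from the left makes it block lower triangular, with a different diagonal block
  surviving in each case.\<close>

lemma det_one_plus_swap:
  fixes B C :: "int mat"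
  assumes B: "B \<in> carrier_mat n m" and C: "C \<in> carrier_mat m n"
  shows "Determinant.det (four_block_mat (1\<^sub>m n) (- B) C (1\<^sub>m m)) = Determinant.det (1\<^sub>m m + C * B)"
    and "Determinant.det (1\<^sub>m n + B * C) = Determinant.det (1\<^sub>m m + C * B)"
proof -
  let ?K = "four_block_mat (1\<^sub>m n) (- B) C (1\<^sub>m m)"
  let ?T = "four_block_mat (1\<^sub>m n) B (0\<^sub>m m n) (1\<^sub>m m)"
  have K: "?K \<in> carrier_mat (n + m) (n + m)" and T: "?T \<in> carrier_mat (n + m) (n + m)"
    using B C by auto
  have det_T: "Determinant.det ?T = 1"
    using B by (subst det_four_block_mat_lower_left_zero) auto
  have "?K * ?T = four_block_mat (1\<^sub>m n * 1\<^sub>m n + (- B) * 0\<^sub>m m n) (1\<^sub>m n * B + (- B) * 1\<^sub>m m)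
      (C * 1\<^sub>m n + 1\<^sub>m m * 0\<^sub>m m n) (C * B + 1\<^sub>m m * 1\<^sub>m m)"
    using B C by (intro mult_four_block_mat) auto
  also have "\<dots> = four_block_mat (1\<^sub>m n) (0\<^sub>m n m) C (1\<^sub>m m + C * B)"
    using B C by (intro cong_four_block_mat) (auto simp: add_uminus_minus_mat comm_add_mat[of "C * B" m m])
  finally have KT: "?K * ?T = \<dots>" .
  have "Determinant.det ?K = Determinant.det (?K * ?T)"
    by (simp add: det_mult[OF K T] det_T)
  also have "\<dots> = Determinant.det (1\<^sub>m m + C * B)"
    unfolding KT using B C by (subst det_four_block_mat_upper_right_zero) auto
  finally show *: "Determinant.det ?K = Determinant.det (1\<^sub>m m + C * B)" .
  have "?T * ?K = four_block_mat (1\<^sub>m n * 1\<^sub>m n + B * C) (1\<^sub>m n * (- B) + B * 1\<^sub>m m)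
      (0\<^sub>m m n * 1\<^sub>m n + 1\<^sub>m m * C) (0\<^sub>m m n * (- B) + 1\<^sub>m m * 1\<^sub>m m)"
    using B C by (intro mult_four_block_mat) auto
  also have "\<dots> = four_block_mat (1\<^sub>m n + B * C) (0\<^sub>m n m) C (1\<^sub>m m)"
    using B C by (intro cong_four_block_mat) (auto simp: uminus_l_inv_mat)
  finally have TK: "?T * ?K = \<dots>" .
  have "Determinant.det ?K = Determinant.det (?T * ?K)"
    by (simp add: det_mult[OF T K] det_T)
  also have "\<dots> = Determinant.det (1\<^sub>m n + B * C)"
    unfolding TK using B C by (subst det_four_block_mat_upper_right_zero) auto
  finally show "Determinant.det (1\<^sub>m n + B * C) = Determinant.det (1\<^sub>m m + C * B)"
    using * by simp
qed

text \<open>Intended reading: \<open>X\<close> and \<open>Y\<close> are I - N for the two halves,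
  \<open>U\<close> and \<open>Z\<close> are their path counts, and the remaining matrices select
  distinguished vertices, so that \<open>P' * Q\<close> and \<open>Q' * P\<close> are the adjacency
  matrices of the connecting edges. Multiplication by the inverses of the diagonal blocks gives a
  determinant of size m, which Sylvester's identity turns into det(I + AB) of size k.\<close>

lemma det_glued_blocks:
  fixes X U Y Z P P' Q Q' :: "int mat"
  assumes X: "X \<in> carrier_mat n n" and U: "U \<in> carrier_mat n n"
    and Y: "Y \<in> carrier_mat m m" and Z: "Z \<in> carrier_mat m m"
    and P: "P \<in> carrier_mat k n" and P': "P' \<in> carrier_mat n k"
    and Q: "Q \<in> carrier_mat k m" and Q': "Q' \<in> carrier_mat m k"
    and XU: "X * U = 1\<^sub>m n" and YZ: "Y * Z = 1\<^sub>m m"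
    and det: "Determinant.det X = 1" "Determinant.det Y = 1"
  shows "Determinant.det (four_block_mat X (- (P' * Q)) (Q' * P) Y) =
    Determinant.det (four_block_mat (P * U * P') (1\<^sub>m k) (- 1\<^sub>m k) (Q * Z * Q'))"
proof -
  let ?K = "four_block_mat X (- (P' * Q)) (Q' * P) Y"
  let ?D = "four_block_mat U (0\<^sub>m n m) (0\<^sub>m m n) Z"
  let ?A = "P * U * P'" and ?B = "Q * Z * Q'"
  have PU: "P * U \<in> carrier_mat k n" and QZ: "Q * Z \<in> carrier_mat k m"
    and PQ: "P' * (Q * Z) \<in> carrier_mat n m" and QP: "Q' * (P * U) \<in> carrier_mat m n"
    and A: "?A \<in> carrier_mat k k" and B: "?B \<in> carrier_mat k k"
    and AQZ: "?A * (Q * Z) \<in> carrier_mat k m"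
    and off: "- (P' * Q) \<in> carrier_mat n m" "Q' * P \<in> carrier_mat m n"
    using P P' Q Q' U Z by auto
  have "Determinant.det U = 1" "Determinant.det Z = 1"
    using det_mult[OF X U] det_mult[OF Y Z] XU YZ det by simp_all
  then have det_D: "Determinant.det ?D = 1"
    using U Z by (subst det_four_block_mat_lower_left_zero) auto
  have "?K * ?D = four_block_mat (X * U + - (P' * Q) * 0\<^sub>m m n) (X * 0\<^sub>m n m + - (P' * Q) * Z)
      (Q' * P * U + Y * 0\<^sub>m m n) (Q' * P * 0\<^sub>m n m + Y * Z)"
    by (rule mult_four_block_mat[OF X off Y U _ _ Z]) auto
  also have "\<dots> = four_block_mat (1\<^sub>m n) (- (P' * (Q * Z))) (Q' * (P * U)) (1\<^sub>m m)"
  proof (intro cong_four_block_mat)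
    show "X * U + - (P' * Q) * 0\<^sub>m m n = 1\<^sub>m n"
      using right_mult_zero_mat[OF off(1)] by (simp add: XU)
    have "- (P' * Q) * Z = - (P' * Q * Z)"
      using P' Q Z by (intro uminus_mult_left_mat) auto
    then show "X * 0\<^sub>m n m + - (P' * Q) * Z = - (P' * (Q * Z))"
      using PQ by (simp add: right_mult_zero_mat[OF X] assoc_mult_mat[OF P' Q Z])
    show "Q' * P * U + Y * 0\<^sub>m m n = Q' * (P * U)"
      using QP by (simp add: right_mult_zero_mat[OF Y] assoc_mult_mat[OF Q' P U])
    show "Q' * P * 0\<^sub>m n m + Y * Z = 1\<^sub>m m"
      by (simp add: right_mult_zero_mat[OF off(2)] YZ)
  qed
  finally have KD: "?K * ?D = \<dots>" .
  have D: "?D \<in> carrier_mat (n + m) (n + m)" and K: "?K \<in> carrier_mat (n + m) (n + m)"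
    using X U Y Z by auto
  have "Determinant.det ?K = Determinant.det (?K * ?D)"
    by (simp add: det_mult[OF K D] det_D)
  also have "\<dots> = Determinant.det (1\<^sub>m m + Q' * (P * U) * (P' * (Q * Z)))"
    unfolding KD by (rule det_one_plus_swap(1)[OF PQ QP])
  also have "Q' * (P * U) * (P' * (Q * Z)) = Q' * (?A * (Q * Z))"
    by (simp only: assoc_mult_mat[OF Q' PU PQ] assoc_mult_mat[OF PU P' QZ])
  also have "Determinant.det (1\<^sub>m m + \<dots>) = Determinant.det (1\<^sub>m k + ?A * (Q * Z) * Q')"
    by (rule det_one_plus_swap(2)[OF AQZ Q', symmetric])
  also have "?A * (Q * Z) * Q' = ?A * ?B"
    by (rule assoc_mult_mat[OF A QZ Q'])
  \<comment> \<open>The shape AD - BC of a block determinant whose lower blocks commute, as a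
    multiple of the identity does with every matrix.\<close>
  also have "1\<^sub>m k + ?A * ?B = ?A * ?B - 1\<^sub>m k * (- 1\<^sub>m k)"
  proof -
    have "1\<^sub>m k + M = M - 1\<^sub>m k * (- 1\<^sub>m k)" if "M \<in> carrier_mat k k" for M :: "int mat"
      using that by (intro eq_matI) auto
    then show ?thesis using A B by (meson mult_carrier_mat)
  qed
  also have "Determinant.det \<dots> = Determinant.det (four_block_mat ?A (1\<^sub>m k) (- 1\<^sub>m k) ?B)"
  proof -
    have "- 1\<^sub>m k * M = M * - 1\<^sub>m k" if M: "M \<in> carrier_mat k k" for M :: "int mat"
    proof -
      have "- 1\<^sub>m k * M = - (1\<^sub>m k * M)" "M * - 1\<^sub>m k = - (M * 1\<^sub>m k)"
        using M by (auto intro!: uminus_mult_left_mat uminus_mult_right_mat)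
      then show ?thesis using M by simp
    qed
    from det_four_block_mat[OF A one_carrier_mat _ B this[OF B]] show ?thesis
      by simp
  qed
  finally show ?thesis .
qed

section \<open>Transfer to digraphs\<close>

lemma (in pre_digraph) cas_iff: "cas u p v \<longleftrightarrow> map (tail G) p @ [v] = u # map (head G) p"
  by (induction p arbitrary: u) auto

text \<open>The library asks the vertices of the closed walk after its start to be distinct. These
  are the heads, a rotation of the tails, so the condition can be moved to the tails.\<close>

lemma (in wf_digraph) cycle_iff_closed_cycle:
  "cycle c \<longleftrightarrow> set c \<subseteq> arcs G \<and> closed_cycle (tail G) (head G) c"
proof (cases c)
  case (Cons a p)
  have "tl (awalk_verts u c) = map (head G) c" if "cas u c u" for u
    using that awalk_verts_conv'[of u c u] Cons by simp
  then have "cycle c \<longleftrightarrow> (\<exists>u. u \<in> verts G \<and> set c \<subseteq> arcs G \<and>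
      map (tail G) c @ [u] = u # map (head G) c \<and> distinct (map (head G) c))"
    unfolding cycle_def awalk_def cas_iff[symmetric] using Cons by auto
  also have "\<dots> \<longleftrightarrow> set c \<subseteq> arcs G \<and> closed_cycle (tail G) (head G) c"
  proof -
    have "map (tail G) c @ [u] = u # map (head G) c \<longleftrightarrow>
        u = tail G a \<and> map (head G) c = rotate1 (map (tail G) c)" for u
      by (auto simp: Cons)
    moreover have "tail G a \<in> verts G" if "set c \<subseteq> arcs G" using that Cons by simp
    moreover have "distinct (map (head G) c) \<longleftrightarrow> distinct (map (tail G) c)"
      if "map (head G) c = rotate1 (map (tail G) c)" using that by simp
    ultimately show ?thesis
      unfolding closed_cycle_def using Cons by (metis list.distinct(1))
  qed
  finally show ?thesis .
qed (simp add: cycle_def closed_cycle_def)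

lemma (in wf_digraph) cycle_system_iff_cycle_family:
  "cycle_system G \<C> \<longleftrightarrow> cycle_family (tail G) (head G) (arcs G) \<C>"
proof -
  have "(\<exists>c. cycle c \<and> C = set c) \<longleftrightarrow>
      C \<subseteq> arcs G \<and> (\<exists>c. closed_cycle (tail G) (head G) c \<and> C = set c)" for C
    unfolding cycle_iff_closed_cycle by blast
  then show ?thesis by (simp add: cycle_system_def cycle_family_def)
qed

text \<open>All conditions compare vertices for equality, which an injective renaming preserves and
  reflects.\<close>

lemma cycle_family_comp:
  assumes inj: "inj_on g V" and A: "t ` A \<subseteq> V" "h ` A \<subseteq> V"
  shows "cycle_family (g \<circ> t) (g \<circ> h) A \<C> \<longleftrightarrow> cycle_family t h A \<C>"
proof -
  have cyc: "closed_cycle (g \<circ> t) (g \<circ> h) c \<longleftrightarrow> closed_cycle t h c" if "set c \<subseteq> A" for c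
  proof -
    have sub: "set (map t c) \<subseteq> V" "set (map h c) \<subseteq> V" using that A by auto
    have "distinct (map g (map t c)) \<longleftrightarrow> distinct (map t c)"
      using inj_on_subset[OF inj sub(1)] by (simp only: distinct_map) auto
    moreover have "map g (map h c) = map g (rotate1 (map t c)) \<longleftrightarrow> map h c = rotate1 (map t c)"
      using sub by (intro inj_on_map_eq_map inj_on_subset[OF inj]) auto
    ultimately show ?thesis
      by (simp add: closed_cycle_def rotate1_map)
  qed
  have disj: "(g \<circ> t) ` C \<inter> (g \<circ> t) ` D = {} \<longleftrightarrow> t ` C \<inter> t ` D = {}" if "C \<subseteq> A" "D \<subseteq> A" for C D
  proof -
    have "t ` C \<subseteq> V" "t ` D \<subseteq> V" using that A by auto
    then have "g ` (t ` C \<inter> t ` D) = g ` t ` C \<inter> g ` t ` D"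
      by (rule inj_on_image_Int[OF inj])
    then show ?thesis by (metis image_comp image_is_empty)
  qed
  have members: "(C \<subseteq> A \<and> (\<exists>c. closed_cycle (g \<circ> t) (g \<circ> h) c \<and> C = set c)) \<longleftrightarrow>
      (C \<subseteq> A \<and> (\<exists>c. closed_cycle t h c \<and> C = set c))" for C
    using cyc by blast
  show ?thesis
    unfolding cycle_family_def members
  proof (rule conj_cong[OF refl])
    assume "\<forall>C\<in>\<C>. C \<subseteq> A \<and> (\<exists>c. closed_cycle t h c \<and> C = set c)"
    then have "\<forall>C\<in>\<C>. C \<subseteq> A" by simp
    then show "(\<forall>C\<in>\<C>. \<forall>D\<in>\<C>. C \<noteq> D \<longrightarrow> (g \<circ> t) ` C \<inter> (g \<circ> t) ` D = {}) \<longleftrightarrow>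
        (\<forall>C\<in>\<C>. \<forall>D\<in>\<C>. C \<noteq> D \<longrightarrow> t ` C \<inter> t ` D = {})"
      using disj by (intro ball_cong imp_cong refl) simp
  qed
qed

lemma (in fin_digraph) det_cycle_systems:
  fixes \<omega> :: "'b \<Rightarrow> int"
  assumes f: "bij_betw f {0..<n} (verts G)" and loopfree: "\<And>a. a \<in> arcs G \<Longrightarrow> tail G a \<noteq> head G a"
  shows "Determinant.det (mat n n (\<lambda>(i, j). of_bool (i = j) -
      (\<Sum>a | a \<in> arcs G \<and> tail G a = f i \<and> head G a = f j. \<omega> a)))
    = (\<Sum>\<C> | cycle_system G \<C>. (- 1) ^ card \<C> * (\<Prod>a\<in>\<Union>\<C>. \<omega> a))"
proof -
  define g where "g = the_inv_into {0..<n} f"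
  have inj_f: "inj_on f {0..<n}" and im_f: "f ` {0..<n} = verts G"
    using f by (auto simp: bij_betw_def)
  have g: "bij_betw g (verts G) {0..<n}"
    unfolding g_def by (rule bij_betw_the_inv_into[OF f])
  have gf: "g x = i \<longleftrightarrow> x = f i" if "x \<in> verts G" "i < n" for x i
    using that inj_f im_f unfolding g_def by (metis atLeastLessThan_iff f_the_inv_into_f le0 the_inv_into_f_f)
  have g_less: "g x < n" if "x \<in> verts G" for x
    using that g by (auto simp: bij_betw_def)
  have inj_g: "inj_on g (verts G)" using g by (simp add: bij_betw_def)
  have "mat n n (\<lambda>(i, j). of_bool (i = j) -
      (\<Sum>a | a \<in> arcs G \<and> tail G a = f i \<and> head G a = f j. \<omega> a)) =
    mat n n (\<lambda>(i, j). of_bool (i = j) -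
      (\<Sum>a | a \<in> arcs G \<and> (g \<circ> tail G) a = i \<and> (g \<circ> head G) a = j. \<omega> a))"
  proof -
    have "{a. a \<in> arcs G \<and> g (tail G a) = i \<and> g (head G a) = j} =
        {a. a \<in> arcs G \<and> tail G a = f i \<and> head G a = f j}" if "i < n" "j < n" for i j
      using gf[OF tail_in_verts that(1)] gf[OF head_in_verts that(2)] by blast
    then show ?thesis by (intro cong_mat) simp_all
  qed
  also have "Determinant.det \<dots> = (\<Sum>\<C> | cycle_family (g \<circ> tail G) (g \<circ> head G) (arcs G) \<C>.
      (- 1) ^ card \<C> * (\<Prod>a\<in>\<Union>\<C>. \<omega> a))"
  proof (rule det_cycle_families)
    show "(g \<circ> tail G) a \<noteq> (g \<circ> head G) a" if "a \<in> arcs G" for a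
      using loopfree[OF that] inj_g that by (simp add: inj_on_eq_iff)
  qed (simp_all add: g_less)
  also have "{\<C>. cycle_family (g \<circ> tail G) (g \<circ> head G) (arcs G) \<C>} = {\<C>. cycle_system G \<C>}"
  proof -
    have "tail G ` arcs G \<subseteq> verts G" "head G ` arcs G \<subseteq> verts G" by auto
    from cycle_family_comp[OF inj_g this] show ?thesis
      by (simp add: cycle_system_iff_cycle_family)
  qed
  finally show ?thesis .
qed

section \<open>Path counts in acyclic digraphs\<close>

locale acyclic_digraph = fin_digraph +
  assumes acyclic: "\<nexists>c. cycle c"
begin

text \<open>A repeated vertex would cut out a closed subwalk, which contains a cycle.\<close>

lemma awalk_imp_apath: "awalk u p v \<Longrightarrow> apath u p v"
  using acyclic closed_w_imp_cycle awalk_cyc_decompE' unfolding apath_def by metis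

lemma no_loop: "a \<in> arcs G \<Longrightarrow> tail G a \<noteq> head G a"
  using acyclic arc_implies_awalk[of a]
  by (metis awalk_imp_apath apath_nonempty_ends list.distinct(1))

text \<open>Paths are split by their first arc. Since every walk is a path here, an arc can be put
  in front of a path without checking for repeated vertices.\<close>

lemma path_count_step:
  assumes "u \<in> verts G"
  shows "int (card {p. apath u p v}) =
    of_bool (u = v) + (\<Sum>a | a \<in> arcs G \<and> tail G a = u. int (card {p. apath (head G a) p v}))"
proof -
  let ?E = "{a \<in> arcs G. tail G a = u}"
  let ?T = "\<Union>a\<in>?E. (#) a ` {p. apath (head G a) p v}"
  have apath_iff: "apath x p y \<longleftrightarrow> awalk x p y" for x p y
    using awalk_imp_apath awalkI_apath by blast
  have "{p. apath u p v} = (if u = v then {[]} else {}) \<union> ?T"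
  proof (rule Set.set_eqI)
    fix p
    show "p \<in> {p. apath u p v} \<longleftrightarrow> p \<in> (if u = v then {[]} else {}) \<union> ?T"
      using assms by (cases p) (auto simp: apath_iff awalk_simps)
  qed
  moreover have "card ?T = (\<Sum>a\<in>?E. card ((#) a ` {p. apath (head G a) p v}))"
    by (intro card_UN_disjoint) (auto simp: apaths_finite)
  moreover have "\<dots> = (\<Sum>a\<in>?E. card {p. apath (head G a) p v})"
    by (intro sum.cong card_image) auto
  moreover have "finite ?T" "[] \<notin> ?T" by (auto simp: apaths_finite)
  ultimately show ?thesis
    by (cases "u = v") simp_all
qed

text \<open>Splitting paths by the first arc is the matrix identity (I - N) W = I. Over the integers
  this leaves the determinant only up to sign; the cycle expansion fixes it as 1, the empty system
  being the only term.\<close>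

lemma path_count_matrix_inverse:
  assumes f: "bij_betw f {0..<n} (verts G)"
  defines "X \<equiv> mat n n (\<lambda>(i, j). of_bool (i = j) -
    (\<Sum>a | a \<in> arcs G \<and> tail G a = f i \<and> head G a = f j. 1 :: int))"
  shows "X * mat n n (\<lambda>(i, j). int (card {p. apath (f i) p (f j)})) = 1\<^sub>m n"
    and "Determinant.det X = 1"
proof -
  let ?c = "\<lambda>u v. int (card {p. apath u p v})"
  let ?W = "mat n n (\<lambda>(i, j). ?c (f i) (f j))"
  have inj_f: "inj_on f {0..<n}" and im_f: "f ` {0..<n} = verts G"
    using f by (auto simp: bij_betw_def)
  show "X * ?W = 1\<^sub>m n"
  proof (rule eq_matI)
    fix i l assume "i < dim_row (1\<^sub>m n :: int mat)" "l < dim_col (1\<^sub>m n :: int mat)"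
    then have il: "i < n" "l < n" by auto
    let ?E = "{a \<in> arcs G. tail G a = f i}"
    have "(X * ?W) $$ (i, l) = (\<Sum>j = 0..<n. (of_bool (i = j) -
        (\<Sum>a | a \<in> arcs G \<and> tail G a = f i \<and> head G a = f j. 1)) * ?c (f j) (f l))"
      using il by (simp add: X_def scalar_prod_def)
    also have "\<dots> = (\<Sum>j = 0..<n. of_bool (i = j) * ?c (f j) (f l)) -
        (\<Sum>j = 0..<n. \<Sum>a | a \<in> ?E \<and> head G a = f j. ?c (head G a) (f l))"
      by (simp add: left_diff_distrib sum_subtractf sum_distrib_right conj_assoc)
    also have "(\<Sum>j = 0..<n. of_bool (i = j) * ?c (f j) (f l)) = ?c (f i) (f l)"
      using il by (simp add: of_bool_def if_distrib[of "\<lambda>x. x * _"] cong: if_cong)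
    also have "(\<Sum>j = 0..<n. \<Sum>a | a \<in> ?E \<and> head G a = f j. ?c (head G a) (f l)) =
        (\<Sum>x\<in>verts G. \<Sum>a | a \<in> ?E \<and> head G a = x. ?c (head G a) (f l))"
      by (rule sum.reindex_bij_betw[OF f])
    also have "\<dots> = (\<Sum>a\<in>?E. ?c (head G a) (f l))"
      by (intro sum.group) auto
    also have "?c (f i) (f l) - \<dots> = of_bool (f i = f l)"
    proof -
      have "f i \<in> verts G" using im_f il by auto
      from path_count_step[OF this, of "f l"] show ?thesis by simp
    qed
    also have "\<dots> = 1\<^sub>m n $$ (i, l)"
      using inj_f il by (auto simp: inj_on_eq_iff)
    finally show "(X * ?W) $$ (i, l) = 1\<^sub>m n $$ (i, l)" .
  qed (auto simp: X_def)
  have "cycle_system G \<C> \<longleftrightarrow> \<C> = {}" for \<C>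
    using acyclic by (auto simp: cycle_system_def)
  moreover have "Determinant.det X = (\<Sum>\<C> | cycle_system G \<C>. (- 1) ^ card \<C> * (\<Prod>a\<in>\<Union>\<C>. 1))"
    unfolding X_def by (rule det_cycle_systems[OF f no_loop])
  ultimately show "Determinant.det X = 1" by simp
qed

end

section \<open>Noncrossing curves and matchings\<close>

text \<open>The ends alternate along the bottom side of a rectangle that contains both curves, which
  is the interlaced form of the Fashoda theorem. The map \<open>\<phi>\<close> carries pairs to the
  vector type in which that theorem is stated.\<close>

lemma interlaced_paths_meet_upper:
  fixes f g :: "real \<Rightarrow> real \<times> real"
  assumes "path f" "path g"
    and upper: "path_image f \<subseteq> {z. snd z \<ge> s}" "path_image g \<subseteq> {z. snd z \<ge> s}"
    and ends: "pathstart f = (a, s)" "pathfinish f = (c, s)" "pathstart g = (b, s)" "pathfinish g = (d, s)"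
    and order: "a < b" "b < c" "c < d"
  shows "path_image f \<inter> path_image g \<noteq> {}"
proof -
  define \<phi> :: "real \<times> real \<Rightarrow> real^2" where "\<phi> z = fst z *\<^sub>R axis 1 1 + snd z *\<^sub>R axis 2 1" for z
  have \<phi>_nth: "vec_nth (\<phi> z) 1 = fst z" "vec_nth (\<phi> z) 2 = snd z" for z
    by (simp_all add: \<phi>_def axis_def)
  have cont: "continuous_on T \<phi>" for T
    unfolding \<phi>_def by (intro continuous_intros)
  have paths: "path (\<phi> \<circ> f)" "path (\<phi> \<circ> g)"
    using assms cont by (auto intro: path_continuous_image)
  have "bounded (path_image (\<phi> \<circ> f) \<union> path_image (\<phi> \<circ> g))"
    using paths by (simp add: bounded_path_image)
  then obtain r where r: "\<And>x. x \<in> path_image (\<phi> \<circ> f) \<union> path_image (\<phi> \<circ> g) \<Longrightarrow> norm x \<le> r"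
    unfolding bounded_iff by blast
  \<comment> \<open>The bottom side must be the line through the four ends; the other sides only
    have to be far enough away.\<close>
  define lo hi :: "real^2" where "lo = vector [- r, s]" and "hi = vector [r, r]"
  have in_box: "\<phi> z \<in> cbox lo hi" if "z \<in> path_image f \<union> path_image g" for z
  proof -
    have "norm (\<phi> z) \<le> r" using that r by (auto simp: path_image_compose)
    then have "\<bar>vec_nth (\<phi> z) i\<bar> \<le> r" for i
      using component_le_norm_cart order_trans by blast
    from this[of 1] this[of 2] have "\<bar>fst z\<bar> \<le> r" "\<bar>snd z\<bar> \<le> r"
      by (simp_all add: \<phi>_nth)
    then show ?thesis
      using that upper by (auto simp: mem_box_cart forall_2 \<phi>_nth lo_def hi_def)
  qed
  obtain x where "x \<in> path_image (\<phi> \<circ> f)" "x \<in> path_image (\<phi> \<circ> g)"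
    by (rule fashoda_interlace[OF paths, of lo hi])
      (use in_box ends order in
        \<open>auto simp: path_image_compose pathstart_compose pathfinish_compose \<phi>_nth lo_def\<close>)
  then obtain y z where yz: "y \<in> path_image f" "z \<in> path_image g" "\<phi> y = \<phi> z"
    by (auto simp: path_image_compose)
  then have "y = z" using \<phi>_nth by (metis prod.expand)
  then show ?thesis using yz by blast
qed

text \<open>Reflection in the horizontal axis gives the upper case. Both curves are also reversed,
  because below they run from right to left.\<close>

lemma interlaced_paths_meet_lower:
  fixes f g :: "real \<Rightarrow> real \<times> real"
  assumes "path f" "path g"
    and lower: "path_image f \<subseteq> {z. snd z \<le> s}" "path_image g \<subseteq> {z. snd z \<le> s}"
    and ends: "pathstart f = (c, s)" "pathfinish f = (a, s)" "pathstart g = (d, s)" "pathfinish g = (b, s)"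
    and order: "a < b" "b < c" "c < d"
  shows "path_image f \<inter> path_image g \<noteq> {}"
proof -
  define \<phi> :: "real \<times> real \<Rightarrow> real \<times> real" where "\<phi> z = (fst z, - snd z)" for z
  have cont: "continuous_on T \<phi>" for T
    unfolding \<phi>_def by (intro continuous_intros)
  have "path_image (reversepath (\<phi> \<circ> f)) \<inter> path_image (reversepath (\<phi> \<circ> g)) \<noteq> {}"
    by (rule interlaced_paths_meet_upper[where s = "- s" and a = a and b = b and c = c and d = d])
      (use assms cont in \<open>auto simp: path_image_compose pathstart_compose pathfinish_compose \<phi>_def
          intro!: path_continuous_image\<close>)
  then obtain x where x: "x \<in> \<phi> ` path_image f" "x \<in> \<phi> ` path_image g"
    unfolding path_image_reversepath path_image_compose by (metis disjoint_iff)
  obtain y where y: "x = \<phi> y" "y \<in> path_image f" using x(1) by (rule imageE)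
  obtain z where z: "x = \<phi> z" "z \<in> path_image g" using x(2) by (rule imageE)
  have "y = z" using y z by (simp add: \<phi>_def prod_eq_iff)
  then show ?thesis using y z by blast
qed

text \<open>Curves of consecutive arcs are joined. The trivial walk is left out: no curve lies in an
  empty union of images.\<close>

lemma (in wf_digraph) planar_embedding_awalk:
  assumes emb: "planar_embedding G pos \<gamma>"
  shows "\<lbrakk>awalk u p v; p \<noteq> []\<rbrakk> \<Longrightarrow> \<exists>f. path f \<and> pathstart f = pos u \<and> pathfinish f = pos v \<and>
    path_image f \<subseteq> (\<Union>a\<in>set p. path_image (\<gamma> a))"
proof (induction p arbitrary: u)
  case (Cons a p)
  have a: "a \<in> arcs G" "u = tail G a" and walk: "awalk (head G a) p v"
    using Cons.prems by (auto simp: awalk_simps)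
  have \<gamma>: "path (\<gamma> a)" "pathstart (\<gamma> a) = pos u" "pathfinish (\<gamma> a) = pos (head G a)"
    using emb a by (auto simp: planar_embedding_def simple_path_imp_path)
  show ?case
  proof (cases "p = []")
    case True
    then show ?thesis using \<gamma> walk by (intro exI[of _ "\<gamma> a"]) (auto simp: awalk_simps)
  next
    case False
    obtain f where f: "path f" "pathstart f = pos (head G a)" "pathfinish f = pos v"
      "path_image f \<subseteq> (\<Union>b\<in>set p. path_image (\<gamma> b))"
      using Cons.IH[OF walk False] by blast
    have "path_image (\<gamma> a +++ f) \<subseteq> (\<Union>b\<in>set (a # p). path_image (\<gamma> b))"
      using f \<gamma> by (subst path_image_join) auto
    then show ?thesis using f \<gamma> by (intro exI[of _ "\<gamma> a +++ f"]) auto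
  qed
qed simp

lemma planar_embedding_disjoint_images:
  assumes "planar_embedding G pos \<gamma>" "set p \<subseteq> arcs G" "set q \<subseteq> arcs G"
    and "(tail G ` set p \<union> head G ` set p) \<inter> (tail G ` set q \<union> head G ` set q) = {}"
  shows "(\<Union>a\<in>set p. path_image (\<gamma> a)) \<inter> (\<Union>a\<in>set q. path_image (\<gamma> a)) = {}"
proof -
  have "path_image (\<gamma> a) \<inter> path_image (\<gamma> b) = {}" if ab: "a \<in> set p" "b \<in> set q" for a b
  proof -
    have "{tail G a, head G a} \<inter> {tail G b, head G b} = {}" using assms(4) ab by blast
    moreover from this have "a \<noteq> b" by blast
    moreover have "a \<in> arcs G" "b \<in> arcs G" using assms(2,3) ab by auto
    ultimately show ?thesis using assms(1) unfolding planar_embedding_def by blast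
  qed
  then show ?thesis by blast
qed

section \<open>Noncrossing matchings\<close>

text \<open>At the least right end \<open>r\<close> of disagreement, say
  \<open>\<alpha> r < \<beta> r\<close>, the left end \<open>\<beta> r\<close> belongs under
  \<open>\<alpha>\<close> to another right end. A larger one would cross \<open>r\<close>; a smaller
  one has the same partner under both matchings, against injectivity of \<open>\<beta>\<close>. The
  assumption \<open>fixed\<close> excludes \<open>\<beta> r = r\<close>: then \<open>r\<close> would
  be a left end too, forcing \<open>\<alpha> r = r\<close>.\<close>

lemma noncrossing_matching_unique:
  fixes \<sigma> \<tau> :: "nat \<Rightarrow> nat"
  assumes inj: "inj_on \<sigma> R" "inj_on \<tau> R" and image: "\<sigma> ` R = \<tau> ` R"
    and le: "\<And>r. r \<in> R \<Longrightarrow> \<sigma> r \<le> r" "\<And>r. r \<in> R \<Longrightarrow> \<tau> r \<le> r"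
    and fixed: "\<And>r. \<lbrakk>r \<in> R; r \<in> \<sigma> ` R\<rbrakk> \<Longrightarrow> \<sigma> r = r" "\<And>r. \<lbrakk>r \<in> R; r \<in> \<tau> ` R\<rbrakk> \<Longrightarrow> \<tau> r = r"
    and noncrossing:
      "\<And>r r'. \<lbrakk>r \<in> R; r' \<in> R; \<sigma> r < \<sigma> r'; \<sigma> r' < r; r < r'\<rbrakk> \<Longrightarrow> False"
      "\<And>r r'. \<lbrakk>r \<in> R; r' \<in> R; \<tau> r < \<tau> r'; \<tau> r' < r; r < r'\<rbrakk> \<Longrightarrow> False"
  shows "r \<in> R \<Longrightarrow> \<sigma> r = \<tau> r"
proof (induction r rule: less_induct)
  case (less r)
  \<comment> \<open>The roles of \<open>\<sigma>\<close> and \<open>\<tau>\<close> are symmetric, so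
    the smaller value is treated once for generic \<open>\<alpha>\<close> and
    \<open>\<beta>\<close>.\<close>
  have False if less_r: "\<alpha> r < \<beta> r"
    and inj_\<beta>: "inj_on \<beta> R" and image': "\<alpha> ` R = \<beta> ` R" and le_\<beta>: "\<beta> r \<le> r"
    and fixed_\<alpha>: "r \<in> \<alpha> ` R \<Longrightarrow> \<alpha> r = r"
    and nc: "\<And>r'. \<lbrakk>r' \<in> R; \<alpha> r < \<alpha> r'; \<alpha> r' < r; r < r'\<rbrakk> \<Longrightarrow> False"
    and IH: "\<And>r'. \<lbrakk>r' < r; r' \<in> R\<rbrakk> \<Longrightarrow> \<alpha> r' = \<beta> r'" for \<alpha> \<beta> :: "nat \<Rightarrow> nat"
  proof -
    obtain r' where r': "r' \<in> R" "\<alpha> r' = \<beta> r"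
      using image' less.prems by (metis imageE imageI)
    have "\<beta> r \<noteq> r"
      using fixed_\<alpha> less_r image' less.prems by (metis imageI less_irrefl)
    then have "\<beta> r < r" using le_\<beta> by simp
    have "r' \<noteq> r" using less_r r' by auto
    moreover have "\<not> r < r'" using nc[OF r'(1)] less_r r' \<open>\<beta> r < r\<close> by auto
    ultimately have "r' < r" by simp
    then have "\<beta> r' = \<beta> r" using IH r' by metis
    then show False using inj_\<beta> r' less.prems \<open>r' \<noteq> r\<close> by (metis inj_onD)
  qed
  note contra = this
  have "\<not> \<sigma> r < \<tau> r"
  proof
    assume "\<sigma> r < \<tau> r"
    from contra[OF this inj(2) image le(2) fixed(1) noncrossing(1) less.IH] less.prems
    show False by simp
  qed
  moreover have "\<not> \<tau> r < \<sigma> r"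
  proof
    assume "\<tau> r < \<sigma> r"
    from contra[OF this inj(1) image[symmetric] le(1) fixed(2) noncrossing(2) less.IH[symmetric]] less.prems
    show False by simp
  qed
  ultimately show ?case by simp
qed

section \<open>Pieces of a circulation inside a subgraph\<close>

text \<open>Supplies the closure condition of \<open>closed_cycle_subset\<close> for arc sets
  assembled from walks.\<close>

lemma (in wf_digraph) awalk_heads_subset:
  "awalk u p v \<Longrightarrow> insert u (head G ` set p) \<subseteq> insert v (tail G ` set p)"
  by (induction p arbitrary: u) (auto simp: awalk_simps)

lemma (in wf_digraph) awalk_end_cases:
  assumes "awalk u p v"
  shows "p = [] \<and> u = v \<or> v \<in> head G ` set p"
  using assms by (cases p rule: rev_cases) (auto simp: awalk_Nil_iff awlast_append)

text \<open>Going back from the common end, injectivity of heads makes the last arcs equal, and they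
  are peeled off. If one walk runs out first, the arc by which it was entered, which is outside
  \<open>G\<close>, would equal an arc of the other walk, which is inside; so both run out
  together.\<close>

lemma (in wf_digraph) awalks_meeting_start_eq:
  assumes inj: "inj_on (head G) S" and S: "a \<in> S - arcs G" "b \<in> S - arcs G"
    and p: "awalk (head G a) p z" "set p \<subseteq> S" and q: "awalk (head G b) q z" "set q \<subseteq> S"
  shows "a = b"
proof -
  have start: "c = d" if c: "c \<in> S - arcs G" and d: "d \<in> S - arcs G"
    and q: "awalk (head G d) q (head G c)" "set q \<subseteq> S" for c d q
    using awalk_end_cases[OF q(1)]
  proof
    assume "q = [] \<and> head G d = head G c"
    then have "head G c = head G d" by simp
    then show "c = d" using c d by (intro inj_onD[OF inj]) auto
  next
    assume "head G c \<in> head G ` set q"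
    then obtain y where y: "y \<in> set q" "head G c = head G y" by blast
    then have "c = y" using c q(2) by (intro inj_onD[OF inj]) auto
    moreover have "y \<in> arcs G" using y q(1) by (auto simp: awalk_def)
    ultimately show "c = d" using c by simp
  qed
  show ?thesis
    using p q
  proof (induction p arbitrary: q z rule: rev_induct)
    case Nil
    then have "z = head G a" by (simp add: awalk_Nil_iff)
    then show ?case using start[OF S] Nil by simp
  next
    case (snoc x p)
    have x: "x \<in> arcs G" "x \<in> S" "awalk (head G a) p (tail G x)" "z = head G x" "set p \<subseteq> S"
      using snoc.prems by (auto simp: awalk_simps)
    show ?case
    proof (cases q rule: rev_cases)
      case Nil
      then have "z = head G b" using snoc.prems by (simp add: awalk_Nil_iff)
      then show ?thesis using start[OF S(2,1)] snoc.prems by metis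
    next
      case q: (snoc q' y)
      then have y: "y \<in> arcs G" "y \<in> S" "awalk (head G b) q' (tail G y)" "z = head G y" "set q' \<subseteq> S"
        using snoc.prems(3,4) by (auto simp: awalk_simps)
      then have "x = y" using x by (intro inj_onD[OF inj]) auto
      then show ?thesis using snoc.IH[OF x(3,5)] y by simp
    qed
  qed
qed

context acyclic_digraph
begin

text \<open>Acyclicity bounds the length of walks by the number of vertices, so a longest walk in
  \<open>S\<close> exists, and it cannot be extended.\<close>

lemma maximal_awalk_in:
  assumes "x \<in> verts G"
  shows "\<exists>p z. awalk x p z \<and> set p \<subseteq> S \<and> (\<forall>a\<in>S \<inter> arcs G. tail G a \<noteq> z)"
proof -
  let ?P = "\<lambda>p. (\<exists>z. awalk x p z) \<and> set p \<subseteq> S"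
  have "?P []" using assms by (auto simp: awalk_Nil_iff)
  moreover have "length p < card (verts G)" if "?P p" for p
    using that awalk_imp_apath length_apath_less by blast
  ultimately have "\<exists>p. ?P p \<and> (\<forall>q. ?P q \<longrightarrow> length q \<le> length p)"
    by (intro ex_has_greatest_nat[of ?P "[]" length "card (verts G)"]) (auto intro: less_imp_le)
  then obtain p where p: "?P p" and max: "\<And>q. ?P q \<Longrightarrow> length q \<le> length p"
    by blast
  obtain z where z: "awalk x p z" using p by blast
  have "tail G a \<noteq> z" if "a \<in> S \<inter> arcs G" for a
  proof
    assume "tail G a = z"
    then have "awalk x (p @ [a]) (head G a)"
      using z that arc_implies_awalk[of a] by (intro awalk_appendI) auto
    then have "?P (p @ [a])" using p that by auto
    then show False using max[of "p @ [a]"] by simp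
  qed
  then show ?thesis using p z by blast
qed

text \<open>A maximal walk in \<open>S\<close> ends at a head of \<open>S\<close>, hence at a tail
  of \<open>S\<close>; by maximality the arc of \<open>S\<close> leaving there is outside
  \<open>G\<close>.\<close>

lemma circulation_through_walk:
  assumes S: "circulation (tail G) (head G) S" and a: "a \<in> S" "head G a \<in> verts G"
  shows "\<exists>p b. awalk (head G a) p (tail G b) \<and> set p \<subseteq> S \<and> b \<in> S - arcs G"
proof -
  obtain p z where p: "awalk (head G a) p z" "set p \<subseteq> S" "\<forall>b\<in>S \<inter> arcs G. tail G b \<noteq> z"
    using maximal_awalk_in[OF a(2)] by blast
  have "z \<in> head G ` S"
    using awalk_end_cases[OF p(1)] p(2) a(1) by blast
  then obtain b where "b \<in> S" "tail G b = z"
    using S by (metis circulation_def imageE)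
  then show ?thesis using p by blast
qed

end

section \<open>The determinant of a hamburger graph\<close>

text \<open>Multiplication by 0/1 selection matrices cuts the full table of path counts down to the
  distinguished vertices.\<close>

lemma selection_mult:
  fixes F :: "'a \<Rightarrow> 'a \<Rightarrow> int"
  assumes f: "bij_betw f {0..<n} V" and x: "\<And>l. l < k \<Longrightarrow> x l \<in> V" and V: "finite V"
  shows "mat k n (\<lambda>(l, i). of_bool (f i = x l)) * mat n n (\<lambda>(i, j). F (f i) (f j)) *
      mat n k (\<lambda>(i, l). of_bool (f i = x l)) = mat k k (\<lambda>(a, b). F (x a) (x b))"
    (is "?S * ?F * ?T = _")
proof (rule eq_matI)
  have delta: "(\<Sum>i = 0..<n. of_bool (f i = y) * g (f i)) = g y" if "y \<in> V" for y and g :: "'a \<Rightarrow> int"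
  proof -
    have "(\<Sum>i = 0..<n. of_bool (f i = y) * g (f i)) = (\<Sum>u\<in>V. of_bool (u = y) * g u)"
      by (rule sum.reindex_bij_betw[OF f])
    also have "\<dots> = (\<Sum>u\<in>{y}. of_bool (u = y) * g u)"
      using that V by (intro sum.mono_neutral_right) auto
    finally show ?thesis by simp
  qed
  fix a b assume "a < dim_row (mat k k (\<lambda>(a, b). F (x a) (x b)))" "b < dim_col (mat k k (\<lambda>(a, b). F (x a) (x b)))"
  then have ab: "a < k" "b < k" by auto
  have "(?S * ?F) $$ (a, j) = F (x a) (f j)" if "j < n" for j
    using delta[OF x[OF ab(1)], of "\<lambda>u. F u (f j)"] that ab by (simp add: scalar_prod_def)
  moreover have "(?S * ?F * ?T) $$ (a, b) = (\<Sum>j = 0..<n. (?S * ?F) $$ (a, j) * ?T $$ (j, b))"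
    using ab by (subst index_mult_mat) (simp_all add: scalar_prod_def del: index_mult_mat(1))
  ultimately have "(?S * ?F * ?T) $$ (a, b) = (\<Sum>j = 0..<n. F (x a) (f j) * of_bool (f j = x b))"
    using ab by (simp del: index_mult_mat(1))
  also have "\<dots> = F (x a) (x b)"
    using delta[OF x[OF ab(2)], of "F (x a)"] by (simp add: mult.commute)
  finally show "(?S * ?F * ?T) $$ (a, b) = mat k k (\<lambda>(a, b). F (x a) (x b)) $$ (a, b)"
    using ab by simp
qed auto

context hamburger_graph
begin

lemma ends_eq: "tail G1 = tail H" "head G1 = head H" "tail G2 = tail H" "head G2 = head H"
  using subgraphs by (auto simp: subgraph_def compatible_def)

lemma acyclic_digraphs: "acyclic_digraph G1" "acyclic_digraph G2"
proof -
  have "wf_digraph G1" "wf_digraph G2" using subgraphs by (simp_all add: subgraph_def)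
  moreover have "finite (verts G1)" "finite (verts G2)"
    using finite_verts verts_H by simp_all
  moreover have "finite (arcs G1)" "finite (arcs G2)"
    using finite_arcs arcs_H by simp_all
  ultimately show "acyclic_digraph G1" "acyclic_digraph G2"
    using acyclic_G1 acyclic_G2
    by (auto intro!: acyclic_digraph.intro fin_digraph.intro fin_digraph_axioms.intro
        acyclic_digraph_axioms.intro)
qed

sublocale G1: acyclic_digraph G1 by (rule acyclic_digraphs)
sublocale G2: acyclic_digraph G2 by (rule acyclic_digraphs)

lemma distinguished_verts:
  assumes "i \<in> {1..k}"
  shows "v i \<in> verts G1" "w (k + i) \<in> verts G2"
  using v_distinct w_distinct assms by auto

lemma w_eq_iff: "i \<in> {1..k} \<Longrightarrow> j \<in> {1..k} \<Longrightarrow> w (k + i) = w (k + j) \<longleftrightarrow> i = j"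
  using w_distinct(1) by (auto simp: inj_on_eq_iff)

lemma v_eq_iff: "i \<in> {1..k} \<Longrightarrow> j \<in> {1..k} \<Longrightarrow> v i = v j \<longleftrightarrow> i = j"
  using v_distinct(1) by (auto simp: inj_on_eq_iff)

lemma arcs_G1: "a \<in> arcs G1 \<Longrightarrow> tail H a \<in> verts G1 \<and> head H a \<in> verts G1"
  using G1.tail_in_verts G1.head_in_verts by (simp add: ends_eq)

lemma arcs_G2: "a \<in> arcs G2 \<Longrightarrow> tail H a \<in> verts G2 \<and> head H a \<in> verts G2"
  using G2.tail_in_verts G2.head_in_verts by (simp add: ends_eq)

lemma arcs_sub: "a \<in> arcs G1 \<Longrightarrow> a \<in> arcs H" "a \<in> arcs G2 \<Longrightarrow> a \<in> arcs H"
  "i \<in> {1..k} \<Longrightarrow> e i \<in> arcs H" "i \<in> {1..k} \<Longrightarrow> e' i \<in> arcs H"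
  using arcs_H by auto

lemma not_both: "x \<in> verts G1 \<Longrightarrow> x \<notin> verts G2"
  using verts_disjoint by blast

lemma arc_cases:
  assumes "a \<in> arcs H"
  obtains (G1) "a \<in> arcs G1" "tail H a \<in> verts G1" "head H a \<in> verts G1"
    "tail H a \<notin> verts G2" "head H a \<notin> verts G2"
  | (G2) "a \<in> arcs G2" "tail H a \<in> verts G2" "head H a \<in> verts G2"
    "tail H a \<notin> verts G1" "head H a \<notin> verts G1"
  | (down) i where "i \<in> {1..k}" "a = e i" "tail H a = v i" "head H a = w (k + i)"
    "tail H a \<in> verts G1" "head H a \<in> verts G2" "tail H a \<notin> verts G2" "head H a \<notin> verts G1"
  | (up) i where "i \<in> {1..k}" "a = e' i" "tail H a = w (k + i)" "head H a = v i"
    "tail H a \<in> verts G2" "head H a \<in> verts G1" "tail H a \<notin> verts G1" "head H a \<notin> verts G2"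
proof -
  consider "a \<in> arcs G1" | "a \<in> arcs G2" | i where "i \<in> {1..k}" "a = e i"
    | i where "i \<in> {1..k}" "a = e' i"
    using assms arcs_H by blast
  then show thesis
  proof cases
    case 1
    then show ?thesis using arcs_G1[of a] not_both by (intro G1) auto
  next
    case 2
    then show ?thesis using arcs_G2[of a] not_both by (intro G2) auto
  next
    case (3 i)
    then show ?thesis using e_ends[of i] distinguished_verts[of i] not_both by (intro down) auto
  next
    case (4 i)
    then show ?thesis using e'_ends[of i] distinguished_verts[of i] not_both by (intro up) auto
  qed
qed

lemma arcs_G1_iff: "a \<in> arcs G1 \<longleftrightarrow> a \<in> arcs H \<and> tail H a \<in> verts G1 \<and> head H a \<in> verts G1"
proof
  assume "a \<in> arcs G1"
  then show "a \<in> arcs H \<and> tail H a \<in> verts G1 \<and> head H a \<in> verts G1"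
    using arcs_G1 arcs_sub(1) by simp
next
  assume a: "a \<in> arcs H \<and> tail H a \<in> verts G1 \<and> head H a \<in> verts G1"
  then have "a \<in> arcs H" by simp
  then show "a \<in> arcs G1" by (cases rule: arc_cases) (use a in auto)
qed

lemma arcs_G2_iff: "a \<in> arcs G2 \<longleftrightarrow> a \<in> arcs H \<and> tail H a \<in> verts G2 \<and> head H a \<in> verts G2"
proof
  assume "a \<in> arcs G2"
  then show "a \<in> arcs H \<and> tail H a \<in> verts G2 \<and> head H a \<in> verts G2"
    using arcs_G2 arcs_sub(2) by simp
next
  assume a: "a \<in> arcs H \<and> tail H a \<in> verts G2 \<and> head H a \<in> verts G2"
  then have "a \<in> arcs H" by simp
  then show "a \<in> arcs G2" by (cases rule: arc_cases) (use a in auto)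
qed

lemma down_iff: "a \<in> e ` {1..k} \<longleftrightarrow> a \<in> arcs H \<and> tail H a \<in> verts G1 \<and> head H a \<in> verts G2"
proof
  assume "a \<in> e ` {1..k}"
  then obtain i where "i \<in> {1..k}" "a = e i" by blast
  then show "a \<in> arcs H \<and> tail H a \<in> verts G1 \<and> head H a \<in> verts G2"
    using e_ends distinguished_verts arcs_sub(3) by simp
next
  assume a: "a \<in> arcs H \<and> tail H a \<in> verts G1 \<and> head H a \<in> verts G2"
  then have "a \<in> arcs H" by simp
  then show "a \<in> e ` {1..k}" by (cases rule: arc_cases) (use a in auto)
qed

lemma up_iff: "a \<in> e' ` {1..k} \<longleftrightarrow> a \<in> arcs H \<and> tail H a \<in> verts G2 \<and> head H a \<in> verts G1"
proof
  assume "a \<in> e' ` {1..k}"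
  then obtain i where "i \<in> {1..k}" "a = e' i" by blast
  then show "a \<in> arcs H \<and> tail H a \<in> verts G2 \<and> head H a \<in> verts G1"
    using e'_ends distinguished_verts arcs_sub(4) by simp
next
  assume a: "a \<in> arcs H \<and> tail H a \<in> verts G2 \<and> head H a \<in> verts G1"
  then have "a \<in> arcs H" by simp
  then show "a \<in> e' ` {1..k}" by (cases rule: arc_cases) (use a in auto)
qed

lemma loopfree_H:
  assumes "a \<in> arcs H"
  shows "tail H a \<noteq> head H a"
  using assms
  by (cases rule: arc_cases) (use G1.no_loop[of a] G2.no_loop[of a] in \<open>auto simp: ends_eq\<close>)

text \<open>The right side is an entry of a product of two selection matrices, the form in which
  \<open>det_glued_blocks\<close> takes the connecting edges.\<close>

lemma sum_down:
  "(\<Sum>a | a \<in> arcs H \<and> tail H a = x \<and> head H a = y. 1 :: int) =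
    (\<Sum>l = 0..<k. of_bool (x = v (Suc l)) * of_bool (y = w (k + Suc l)))"
  if "x \<in> verts G1" "y \<in> verts G2"
proof -
  let ?L = "{l \<in> {0..<k}. x = v (Suc l) \<and> y = w (k + Suc l)}"
  have "{a. a \<in> arcs H \<and> tail H a = x \<and> head H a = y} = (\<lambda>l. e (Suc l)) ` ?L"
  proof (intro Set.set_eqI iffI)
    fix a assume a: "a \<in> {a. a \<in> arcs H \<and> tail H a = x \<and> head H a = y}"
    then have "a \<in> e ` {1..k}" unfolding down_iff using that by blast
    then obtain i where i: "i \<in> {1..k}" "a = e i" by blast
    \<comment> \<open>Connecting edges are numbered from 1, matrix indices from 0.\<close>
    then have "i - 1 \<in> ?L" "a = e (Suc (i - 1))" using a e_ends[of i] by auto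
    then show "a \<in> (\<lambda>l. e (Suc l)) ` ?L" by blast
  next
    fix a assume "a \<in> (\<lambda>l. e (Suc l)) ` ?L"
    then show "a \<in> {a. a \<in> arcs H \<and> tail H a = x \<and> head H a = y}"
      using e_ends arcs_sub(3) by auto
  qed
  moreover have "inj_on (\<lambda>l. e (Suc l)) ?L"
  proof (rule inj_onI)
    fix l m assume "l \<in> ?L" "m \<in> ?L" "e (Suc l) = e (Suc m)"
    then show "l = m" using e_ends[of "Suc l"] e_ends[of "Suc m"] v_eq_iff[of "Suc l" "Suc m"] by auto
  qed
  ultimately have "(\<Sum>a | a \<in> arcs H \<and> tail H a = x \<and> head H a = y. 1 :: int) = (\<Sum>l\<in>?L. 1)"
    by (simp add: card_image)
  also have "\<dots> = (\<Sum>l = 0..<k. of_bool (x = v (Suc l)) * of_bool (y = w (k + Suc l)))"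
    by (rule sum.mono_neutral_cong_left) auto
  finally show ?thesis .
qed

lemma sum_up:
  "(\<Sum>a | a \<in> arcs H \<and> tail H a = y \<and> head H a = x. 1 :: int) =
    (\<Sum>l = 0..<k. of_bool (y = w (k + Suc l)) * of_bool (x = v (Suc l)))"
  if "x \<in> verts G1" "y \<in> verts G2"
proof -
  let ?L = "{l \<in> {0..<k}. y = w (k + Suc l) \<and> x = v (Suc l)}"
  have "{a. a \<in> arcs H \<and> tail H a = y \<and> head H a = x} = (\<lambda>l. e' (Suc l)) ` ?L"
  proof (intro Set.set_eqI iffI)
    fix a assume a: "a \<in> {a. a \<in> arcs H \<and> tail H a = y \<and> head H a = x}"
    then have "a \<in> e' ` {1..k}" unfolding up_iff using that by blast
    then obtain i where i: "i \<in> {1..k}" "a = e' i" by blast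
    then have "i - 1 \<in> ?L" "a = e' (Suc (i - 1))" using a e'_ends[of i] by auto
    then show "a \<in> (\<lambda>l. e' (Suc l)) ` ?L" by blast
  next
    fix a assume "a \<in> (\<lambda>l. e' (Suc l)) ` ?L"
    then show "a \<in> {a. a \<in> arcs H \<and> tail H a = y \<and> head H a = x}"
      using e'_ends arcs_sub(4) by auto
  qed
  moreover have "inj_on (\<lambda>l. e' (Suc l)) ?L"
  proof (rule inj_onI)
    fix l m assume "l \<in> ?L" "m \<in> ?L" "e' (Suc l) = e' (Suc m)"
    then show "l = m" using e'_ends[of "Suc l"] e'_ends[of "Suc m"] v_eq_iff[of "Suc l" "Suc m"] by auto
  qed
  ultimately have "(\<Sum>a | a \<in> arcs H \<and> tail H a = y \<and> head H a = x. 1 :: int) = (\<Sum>l\<in>?L. 1)"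
    by (simp add: card_image)
  also have "\<dots> = (\<Sum>l = 0..<k. of_bool (y = w (k + Suc l)) * of_bool (x = v (Suc l)))"
    by (rule sum.mono_neutral_cong_left) auto
  finally show ?thesis .
qed

lemma det_hamburger_matrix:
  "Determinant.det (hamburger_matrix G1 G2 k v w) =
    (\<Sum>\<C> | cycle_system H \<C>. (- 1) ^ (upward_edge_count H G1 G2 \<C> + card \<C>))"
proof -
  define n1 n2 where "n1 = card (verts G1)" and "n2 = card (verts G2)"
  obtain f1 f2 where f1: "bij_betw f1 {0..<n1} (verts G1)" and f2: "bij_betw f2 {0..<n2} (verts G2)"
    unfolding n1_def n2_def
    using ex_bij_betw_nat_finite[OF G1.finite_verts] ex_bij_betw_nat_finite[OF G2.finite_verts] by blast
  \<comment> \<open>Listing the vertices of \<open>G1\<close> before those of \<open>G2\<close>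
    splits the matrix into the four blocks.\<close>
  define f where "f i = (if i < n1 then f1 i else f2 (i - n1))" for i
  define \<omega> :: "'b \<Rightarrow> int" where "\<omega> a = (if a \<in> e' ` {1..k} then - 1 else 1)" for a
  have f1_in: "f1 i \<in> verts G1" if "i < n1" for i
    using bij_betw_apply[OF f1] that by simp
  have f2_in: "f2 i \<in> verts G2" if "i < n2" for i
    using bij_betw_apply[OF f2] that by simp
  have f: "bij_betw f {0..<n1 + n2} (verts H)"
  proof -
    have "bij_betw f {0..<n1} (verts G1)"
      using f1 by (rule bij_betw_cong[THEN iffD1, rotated]) (simp add: f_def)
    moreover have "bij_betw f {n1..<n1 + n2} (verts G2)"
    proof -
      have "bij_betw (\<lambda>i. i - n1) {n1..<n1 + n2} {0..<n2}"
        by (rule bij_betw_byWitness[where f' = "\<lambda>i. i + n1"]) auto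
      then have "bij_betw (f2 \<circ> (\<lambda>i. i - n1)) {n1..<n1 + n2} (verts G2)"
        using f2 by (rule bij_betw_trans)
      then show ?thesis by (rule bij_betw_cong[THEN iffD1, rotated]) (simp add: f_def)
    qed
    ultimately have "bij_betw f ({0..<n1} \<union> {n1..<n1 + n2}) (verts H)"
      unfolding verts_H using verts_disjoint by (intro bij_betw_combine)
    then show ?thesis by (simp add: ivl_disj_un)
  qed
  let ?N = "\<lambda>G n f. mat n n (\<lambda>(i, j). of_bool (i = j) -
    (\<Sum>a | a \<in> arcs G \<and> tail G a = f i \<and> head G a = f j. 1 :: int))"
  let ?W = "\<lambda>G n f. mat n n (\<lambda>(i, j). int (card {p. pre_digraph.apath G (f i) p (f j)}))"
  let ?P = "mat k n1 (\<lambda>(l, i). of_bool (f1 i = v (Suc l))) :: int mat"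
  let ?P' = "mat n1 k (\<lambda>(i, l). of_bool (f1 i = v (Suc l))) :: int mat"
  let ?Q = "mat k n2 (\<lambda>(l, j). of_bool (f2 j = w (k + Suc l))) :: int mat"
  let ?Q' = "mat n2 k (\<lambda>(j, l). of_bool (f2 j = w (k + Suc l))) :: int mat"
  let ?K = "mat (n1 + n2) (n1 + n2) (\<lambda>(i, j). of_bool (i = j) -
      (\<Sum>a | a \<in> arcs H \<and> tail H a = f i \<and> head H a = f j. \<omega> a))"
  have \<omega>_sum: "(\<Sum>a | a \<in> arcs H \<and> tail H a = x \<and> head H a = y. \<omega> a) =
      (if x \<in> verts G2 \<and> y \<in> verts G1 then - 1 else 1) *
      (\<Sum>a | a \<in> arcs H \<and> tail H a = x \<and> head H a = y. 1)" for x y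
  proof -
    have "\<omega> a = (if tail H a \<in> verts G2 \<and> head H a \<in> verts G1 then - 1 else 1)" if "a \<in> arcs H" for a
      using that unfolding \<omega>_def up_iff by simp
    then show ?thesis unfolding sum_distrib_left by (intro sum.cong) auto
  qed
  \<comment> \<open>Upward arcs have weight -1 and enter with a minus sign, hence the plus sign of
    the lower left block.\<close>
  have K_eq: "?K = four_block_mat (?N G1 n1 f1) (- (?P' * ?Q)) (?Q' * ?P) (?N G2 n2 f2)"
  proof (rule eq_matI)
    fix i j
    assume "i < dim_row (four_block_mat (?N G1 n1 f1) (- (?P' * ?Q)) (?Q' * ?P) (?N G2 n2 f2))"
      "j < dim_col (four_block_mat (?N G1 n1 f1) (- (?P' * ?Q)) (?Q' * ?P) (?N G2 n2 f2))"
    then have ij: "i < n1 + n2" "j < n1 + n2" by auto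
    have G1_sum: "(\<Sum>a | a \<in> arcs H \<and> tail H a = x \<and> head H a = y. 1 :: int) =
        (\<Sum>a | a \<in> arcs G1 \<and> tail G1 a = x \<and> head G1 a = y. 1)" if "x \<in> verts G1" "y \<in> verts G1" for x y
      using that by (intro sum.cong) (auto simp: arcs_G1_iff ends_eq)
    have G2_sum: "(\<Sum>a | a \<in> arcs H \<and> tail H a = x \<and> head H a = y. 1 :: int) =
        (\<Sum>a | a \<in> arcs G2 \<and> tail G2 a = x \<and> head G2 a = y. 1)" if "x \<in> verts G2" "y \<in> verts G2" for x y
      using that by (intro sum.cong) (auto simp: arcs_G2_iff ends_eq)
    consider "i < n1" "j < n1" | "i < n1" "\<not> j < n1" | "\<not> i < n1" "j < n1" | "\<not> i < n1" "\<not> j < n1"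
      by blast
    then show "?K $$ (i, j) = four_block_mat (?N G1 n1 f1) (- (?P' * ?Q)) (?Q' * ?P) (?N G2 n2 f2) $$ (i, j)"
    proof cases
      case 1
      then have in_G1: "f1 i \<in> verts G1" "f1 j \<in> verts G1" using f1_in by auto
      have "?K $$ (i, j) = of_bool (i = j) - (\<Sum>a | a \<in> arcs G1 \<and> tail G1 a = f1 i \<and> head G1 a = f1 j. 1)"
        using 1 ij in_G1 not_both by (simp only: index_mat split f_def if_True \<omega>_sum G1_sum) simp
      then show ?thesis using 1 by simp
    next
      case 2
      then have "f1 i \<in> verts G1" "f2 (j - n1) \<in> verts G2" using f1_in f2_in ij by auto
      then have "?K $$ (i, j) = - (\<Sum>l = 0..<k. of_bool (f1 i = v (Suc l)) * of_bool (f2 (j - n1) = w (k + Suc l)))"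
        using 2 ij not_both by (simp only: index_mat split f_def if_True if_False \<omega>_sum sum_down) auto
      then show ?thesis using 2 ij by (simp add: scalar_prod_def)
    next
      case 3
      then have "f1 j \<in> verts G1" "f2 (i - n1) \<in> verts G2" using f1_in f2_in ij by auto
      then have "?K $$ (i, j) = (\<Sum>l = 0..<k. of_bool (f2 (i - n1) = w (k + Suc l)) * of_bool (f1 j = v (Suc l)))"
        using 3 ij by (simp only: index_mat split f_def if_True if_False \<omega>_sum sum_up) auto
      then show ?thesis using 3 ij by (simp add: scalar_prod_def)
    next
      case 4
      then have in_G2: "f2 (i - n1) \<in> verts G2" "f2 (j - n1) \<in> verts G2" using f2_in ij by auto
      then have "f2 (j - n1) \<notin> verts G1" using not_both by blast
      then have "?K $$ (i, j) = of_bool (i - n1 = j - n1) -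
          (\<Sum>a | a \<in> arcs G2 \<and> tail G2 a = f2 (i - n1) \<and> head G2 a = f2 (j - n1). 1)"
        using 4 ij in_G2 by (simp only: index_mat split f_def if_False \<omega>_sum G2_sum) auto
      then show ?thesis using 4 ij by simp
    qed
  qed auto
  have det_K: "Determinant.det ?K = Determinant.det (four_block_mat (?P * ?W G1 n1 f1 * ?P') (1\<^sub>m k)
      (- 1\<^sub>m k) (?Q * ?W G2 n2 f2 * ?Q'))"
    unfolding K_eq by (rule det_glued_blocks[where n = n1 and m = n2])
      (rule mat_carrier G1.path_count_matrix_inverse[OF f1] G2.path_count_matrix_inverse[OF f2])+
  have "?P * ?W G1 n1 f1 * ?P' = path_count_matrix G1 k v"
    unfolding path_count_matrix_def
    by (rule selection_mult[OF f1, where F = "\<lambda>x y. int (card {p. pre_digraph.apath G1 x p y})"])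
      (use distinguished_verts in auto)
  moreover have "?Q * ?W G2 n2 f2 * ?Q' = path_count_matrix G2 k (\<lambda>i. w (k + i))"
    unfolding path_count_matrix_def
    by (rule selection_mult[OF f2, where F = "\<lambda>x y. int (card {p. pre_digraph.apath G2 x p y})"])
      (use distinguished_verts(2)[of "Suc _"] in auto)
  ultimately have "Determinant.det (hamburger_matrix G1 G2 k v w) = Determinant.det ?K"
    unfolding hamburger_matrix_def det_K by (simp only:)
  also have "\<dots> = (\<Sum>\<C> | cycle_system H \<C>. (- 1) ^ card \<C> * (\<Prod>a\<in>\<Union>\<C>. \<omega> a))"
    by (rule det_cycle_systems[OF f loopfree_H])
  also have "\<dots> = (\<Sum>\<C> | cycle_system H \<C>. (- 1) ^ (upward_edge_count H G1 G2 \<C> + card \<C>))"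
  proof (intro sum.cong refl)
    fix \<C> assume "\<C> \<in> {\<C>. cycle_system H \<C>}"
    then have sub: "\<Union>\<C> \<subseteq> arcs H"
      by (auto simp: cycle_system_iff_cycle_family cycle_family_def)
    have fin: "finite (\<Union>\<C>)" using sub finite_arcs by (rule finite_subset)
    have "(\<Prod>a\<in>\<Union>\<C>. \<omega> a) = (\<Prod>a\<in>\<Union>\<C> \<inter> {a. a \<in> e' ` {1..k}}. - 1) * (\<Prod>a\<in>\<Union>\<C> \<inter> - {a. a \<in> e' ` {1..k}}. 1)"
      unfolding \<omega>_def by (rule prod.If_cases[OF fin])
    also have "\<dots> = (- 1) ^ card (\<Union>\<C> \<inter> {a. a \<in> e' ` {1..k}})" by simp
    also have "\<Union>\<C> \<inter> {a. a \<in> e' ` {1..k}} = {a \<in> \<Union>\<C>. tail H a \<in> verts G2 \<and> head H a \<in> verts G1}"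
      unfolding up_iff using sub by blast
    finally show "(- 1) ^ card \<C> * (\<Prod>a\<in>\<Union>\<C>. \<omega> a) = (- 1) ^ (upward_edge_count H G1 G2 \<C> + card \<C>)"
      by (simp add: upward_edge_count_def power_add)
  qed
  finally show ?thesis .
qed

end

section \<open>Strongly planar hamburger graphs\<close>

text \<open>Cutting both walks off at the shared vertex gives them a common end.\<close>

lemma (in wf_digraph) awalks_sharing_vertex_start_eq:
  assumes "inj_on (head G) S" "a \<in> S - arcs G" "b \<in> S - arcs G"
    and p: "awalk (head G a) p y" "set p \<subseteq> S" and q: "awalk (head G b) q y'" "set q \<subseteq> S"
    and meet: "set (awalk_verts (head G a) p) \<inter> set (awalk_verts (head G b) q) \<noteq> {}"
  shows "a = b"
proof -
  obtain z where z: "z \<in> set (awalk_verts (head G a) p)" "z \<in> set (awalk_verts (head G b) q)"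
    using meet by blast
  obtain p1 p2 where p1: "p = p1 @ p2" "awalk (head G a) p1 z"
    using awalk_decomp[OF p(1) z(1)] by blast
  obtain q1 q2 where q1: "q = q1 @ q2" "awalk (head G b) q1 z"
    using awalk_decomp[OF q(1) z(2)] by blast
  show ?thesis
    using awalks_meeting_start_eq[OF assms(1-3) p1(2) _ q1(2)] p(2) q(2) p1(1) q1(1) by simp
qed

lemma planar_embedding_subgraph:
  assumes "planar_embedding H pos \<gamma>" "subgraph G H"
  shows "planar_embedding G pos \<gamma>"
proof -
  have eq: "tail G = tail H" "head G = head H" and sub: "verts G \<subseteq> verts H" "arcs G \<subseteq> arcs H"
    using assms(2) by (auto simp: subgraph_def compatible_def)
  show ?thesis
    unfolding planar_embedding_def eq
  proof (intro conjI)
    have "inj_on pos (verts H)" using assms(1) by (simp add: planar_embedding_def)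
    then show "inj_on pos (verts G)" using sub(1) by (rule inj_on_subset)
  qed (use assms(1) subsetD[OF sub(1)] subsetD[OF sub(2)] in \<open>simp_all add: planar_embedding_def\<close>)
qed

text \<open>Vertex-disjoint walks would be drawn as disjoint curves. The topological fact is passed
  in as \<open>meet\<close>, so that both half planes can use the same argument.\<close>

lemma (in wf_digraph) planar_awalks_meet:
  assumes emb: "planar_embedding G pos \<gamma>"
    and p: "awalk x p y" "p \<noteq> []" and q: "awalk x' q y'" "q \<noteq> []"
    and meet: "\<And>f g. \<lbrakk>path f; pathstart f = pos x; pathfinish f = pos y;
        path g; pathstart g = pos x'; pathfinish g = pos y';
        path_image f \<subseteq> (\<Union>a\<in>arcs G. path_image (\<gamma> a)); path_image g \<subseteq> (\<Union>a\<in>arcs G. path_image (\<gamma> a))\<rbrakk>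
      \<Longrightarrow> path_image f \<inter> path_image g \<noteq> {}"
  shows "set (awalk_verts x p) \<inter> set (awalk_verts x' q) \<noteq> {}"
proof
  assume disj: "set (awalk_verts x p) \<inter> set (awalk_verts x' q) = {}"
  have arcs: "set p \<subseteq> arcs G" "set q \<subseteq> arcs G" using p q by auto
  obtain f where f: "path f" "pathstart f = pos x" "pathfinish f = pos y"
    "path_image f \<subseteq> (\<Union>a\<in>set p. path_image (\<gamma> a))"
    using planar_embedding_awalk[OF emb p] by blast
  obtain g where g: "path g" "pathstart g = pos x'" "pathfinish g = pos y'"
    "path_image g \<subseteq> (\<Union>a\<in>set q. path_image (\<gamma> a))"
    using planar_embedding_awalk[OF emb q] by blast
  have "(tail G ` set p \<union> head G ` set p) \<inter> (tail G ` set q \<union> head G ` set q) = {}"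
    using disj unfolding set_awalk_verts[OF p(1)] set_awalk_verts[OF q(1)] by auto
  from planar_embedding_disjoint_images[OF emb arcs this]
  have "path_image f \<inter> path_image g = {}" using f(4) g(4) by blast
  moreover have "path_image f \<subseteq> (\<Union>a\<in>arcs G. path_image (\<gamma> a))"
    "path_image g \<subseteq> (\<Union>a\<in>arcs G. path_image (\<gamma> a))"
    using f(4) g(4) arcs by blast+
  ultimately show False using meet[OF f(1-3) g(1-3)] by blast
qed

lemma (in wf_digraph) interlaced_awalks_meet_upper:
  assumes emb: "planar_embedding G pos \<gamma>" and upper: "\<forall>a\<in>arcs G. path_image (\<gamma> a) \<subseteq> {z. snd z \<ge> s}"
    and p: "awalk x p y" and q: "awalk x' q y'"
    and pos: "pos x = (a, s)" "pos y = (c, s)" "pos x' = (b, s)" "pos y' = (d, s)"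
    and order: "a < b" "b < c" "c < d"
  shows "set (awalk_verts x p) \<inter> set (awalk_verts x' q) \<noteq> {}"
proof (rule planar_awalks_meet[OF emb p _ q])
  show "p \<noteq> []" "q \<noteq> []" using p q pos order by (auto simp: awalk_Nil_iff)
  have sub: "(\<Union>a\<in>arcs G. path_image (\<gamma> a)) \<subseteq> {z. snd z \<ge> s}" using upper by blast
  fix f g :: "real \<Rightarrow> real \<times> real"
  assume "path f" "pathstart f = pos x" "pathfinish f = pos y"
    "path g" "pathstart g = pos x'" "pathfinish g = pos y'"
    "path_image f \<subseteq> (\<Union>a\<in>arcs G. path_image (\<gamma> a))" "path_image g \<subseteq> (\<Union>a\<in>arcs G. path_image (\<gamma> a))"
  then show "path_image f \<inter> path_image g \<noteq> {}"
    using sub pos by (intro interlaced_paths_meet_upper[OF _ _ _ _ _ _ _ _ order, of f g s]) auto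
qed

lemma (in wf_digraph) interlaced_awalks_meet_lower:
  assumes emb: "planar_embedding G pos \<gamma>" and lower: "\<forall>a\<in>arcs G. path_image (\<gamma> a) \<subseteq> {z. snd z \<le> s}"
    and p: "awalk x p y" and q: "awalk x' q y'"
    and pos: "pos x = (c, s)" "pos y = (a, s)" "pos x' = (d, s)" "pos y' = (b, s)"
    and order: "a < b" "b < c" "c < d"
  shows "set (awalk_verts x p) \<inter> set (awalk_verts x' q) \<noteq> {}"
proof (rule planar_awalks_meet[OF emb p _ q])
  show "p \<noteq> []" "q \<noteq> []" using p q pos order by (auto simp: awalk_Nil_iff)
  have sub: "(\<Union>a\<in>arcs G. path_image (\<gamma> a)) \<subseteq> {z. snd z \<le> s}" using lower by blast
  fix f g :: "real \<Rightarrow> real \<times> real"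
  assume "path f" "pathstart f = pos x" "pathfinish f = pos y"
    "path g" "pathstart g = pos x'" "pathfinish g = pos y'"
    "path_image f \<subseteq> (\<Union>a\<in>arcs G. path_image (\<gamma> a))" "path_image g \<subseteq> (\<Union>a\<in>arcs G. path_image (\<gamma> a))"
  then show "path_image f \<inter> path_image g \<noteq> {}"
    using sub pos by (intro interlaced_paths_meet_lower[OF _ _ _ _ _ _ _ _ order, of f g s]) auto
qed

section \<open>The shape of a single cycle\<close>

context hamburger_graph
begin

text \<open>Without a connecting arc the successor of an arc stays in the same half, so the whole
  cycle would lie in one acyclic graph.\<close>

lemma cycle_contains_connecting_arc:
  assumes cyc: "cycle c"
  shows "\<exists>a\<in>set c. a \<in> e ` {1..k} \<union> e' ` {1..k}"
proof (rule ccontr)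
  assume none: "\<not> ?thesis"
  have cc: "closed_cycle (tail H) (head H) c" and sub: "set c \<subseteq> arcs H"
    using cyc by (simp_all add: cycle_iff_closed_cycle)
  have circ: "circulation (tail H) (head H) (set c)" using cc by (rule closed_cycle_circulation)
  have in_parts: "a \<in> arcs G1 \<or> a \<in> arcs G2" if "a \<in> set c" for a
    using that sub none arcs_H by blast
  have closed: "head H ` (set c \<inter> A) \<subseteq> tail H ` (set c \<inter> A)"
    if A: "A = arcs G1 \<or> A = arcs G2" for A
  proof
    fix x assume "x \<in> head H ` (set c \<inter> A)"
    then obtain a where a: "a \<in> set c" "a \<in> A" "x = head H a" by blast
    then have "x \<in> tail H ` set c" using circ by (auto simp: circulation_def)
    then obtain b where b: "b \<in> set c" "x = tail H b" by blast
    then have "b \<in> A"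
      using a A in_parts[OF b(1)] arcs_G1 arcs_G2 not_both by metis
    then show "x \<in> tail H ` (set c \<inter> A)" using b by blast
  qed
  have "hd c \<in> set c" using cc by (simp add: closed_cycle_def)
  then obtain A where A: "A = arcs G1 \<or> A = arcs G2" "hd c \<in> A" using in_parts by blast
  have "inj_on (tail H) (set c \<inter> A \<union> set c)"
    using circ by (simp add: circulation_def Un_absorb1)
  then have "set c \<subseteq> set c \<inter> A"
    using closed_cycle_subset[OF cc _ closed[OF A(1)]] A(2) \<open>hd c \<in> set c\<close> by blast
  then have "pre_digraph.cycle G1 c \<or> pre_digraph.cycle G2 c"
    using A(1) cc by (auto simp: G1.cycle_iff_closed_cycle G2.cycle_iff_closed_cycle ends_eq)
  then show False using acyclic_G1 acyclic_G2 by blast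
qed

lemma unique_up_arc:
  assumes planar: "strongly_planar H G1 G2 k v w" and cyc: "cycle c"
  shows "\<exists>a. {a \<in> set c. a \<in> e' ` {1..k}} = {a}"
proof -
  obtain pos \<gamma> where emb: "planar_embedding H pos \<gamma>"
    and pos_v: "\<And>i. i \<in> {1..k} \<Longrightarrow> pos (v i) = (real i, 1)"
    and pos_w: "\<And>i. i \<in> {1..k} \<Longrightarrow> pos (w (k + i)) = (real i, - 1)"
    and upper: "\<forall>a\<in>arcs G1. path_image (\<gamma> a) \<subseteq> {z. snd z \<ge> 1}"
    and lower: "\<forall>a\<in>arcs G2. path_image (\<gamma> a) \<subseteq> {z. snd z \<le> - 1}"
    using planar unfolding strongly_planar_def by blast
  have emb1: "planar_embedding G1 pos \<gamma>" and emb2: "planar_embedding G2 pos \<gamma>"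
    using planar_embedding_subgraph[OF emb] subgraphs by auto
  define S where "S = set c"
  have cc: "closed_cycle (tail H) (head H) c" and S_sub: "S \<subseteq> arcs H"
    using cyc by (simp_all add: cycle_iff_closed_cycle S_def)
  have circ: "circulation (tail H) (head H) S"
    unfolding S_def using cc by (rule closed_cycle_circulation)
  then have inj_t: "inj_on (tail H) S" and inj_h: "inj_on (head H) S"
    by (simp_all add: circulation_def)
  \<comment> \<open>Each cycle leaves \<open>v j\<close> after an upward edge and next goes down at \<open>v (\<tau> j)\<close>; likewise
    \<open>\<sigma>\<close> leads below from a downward edge to the next upward edge. Planarity makes both
    matchings noncrossing, so they are inverse to each other and the cycle closes at once.\<close>
  define L R where "L = {j \<in> {1..k}. e' j \<in> S}" and "R = {i \<in> {1..k}. e i \<in> S}"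
  have L: "j \<in> {1..k}" "e' j \<in> S" "e' j \<notin> arcs G1" "e' j \<notin> arcs G2" "head H (e' j) = v j"
    "tail H (e' j) = w (k + j)" if "j \<in> L" for j
    using that e'_ends[of j] distinguished_verts[of j] not_both arcs_G1[of "e' j"] arcs_G2[of "e' j"]
    unfolding L_def by auto
  have R: "i \<in> {1..k}" "e i \<in> S" "e i \<notin> arcs G1" "e i \<notin> arcs G2" "head H (e i) = w (k + i)"
    "tail H (e i) = v i" if "i \<in> R" for i
    using that e_ends[of i] distinguished_verts[of i] not_both arcs_G1[of "e i"] arcs_G2[of "e i"]
    unfolding R_def by auto
  have "\<exists>i p. i \<in> R \<and> G1.awalk (v j) p (v i) \<and> set p \<subseteq> S" if j: "j \<in> L" for j
  proof -
    have "head G1 (e' j) \<in> verts G1" using L[OF j] distinguished_verts by (simp add: ends_eq)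
    then obtain p b where b: "G1.awalk (v j) p (tail H b)" "set p \<subseteq> S" "b \<in> S" "b \<notin> arcs G1"
      using G1.circulation_through_walk[of S "e' j"] circ L[OF j] by (auto simp: ends_eq)
    have "b \<in> arcs H" using b S_sub by blast
    moreover have "tail H b \<in> verts G1" using b(1) by (rule G1.awalk_last_in_verts)
    ultimately obtain i where "i \<in> {1..k}" "b = e i" "tail H b = v i"
      using b(4) by (cases rule: arc_cases) auto
    then show ?thesis using b unfolding R_def by auto
  qed
  then obtain \<tau> P where \<tau>: "\<And>j. j \<in> L \<Longrightarrow> \<tau> j \<in> R" "\<And>j. j \<in> L \<Longrightarrow> G1.awalk (v j) (P j) (v (\<tau> j))"
    "\<And>j. j \<in> L \<Longrightarrow> set (P j) \<subseteq> S"
    by metis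
  have "\<exists>j p. j \<in> L \<and> G2.awalk (w (k + i)) p (w (k + j)) \<and> set p \<subseteq> S" if i: "i \<in> R" for i
  proof -
    have "head G2 (e i) \<in> verts G2" using R[OF i] distinguished_verts by (simp add: ends_eq)
    then obtain p b where b: "G2.awalk (w (k + i)) p (tail H b)" "set p \<subseteq> S" "b \<in> S" "b \<notin> arcs G2"
      using G2.circulation_through_walk[of S "e i"] circ R[OF i] by (auto simp: ends_eq)
    have "b \<in> arcs H" using b S_sub by blast
    moreover have "tail H b \<in> verts G2" using b(1) by (rule G2.awalk_last_in_verts)
    ultimately obtain j where "j \<in> {1..k}" "b = e' j" "tail H b = w (k + j)"
      using b(4) by (cases rule: arc_cases) auto
    then show ?thesis using b unfolding L_def by auto
  qed
  then obtain \<sigma> Q where \<sigma>: "\<And>i. i \<in> R \<Longrightarrow> \<sigma> i \<in> L"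
    "\<And>i. i \<in> R \<Longrightarrow> G2.awalk (w (k + i)) (Q i) (w (k + \<sigma> i))" "\<And>i. i \<in> R \<Longrightarrow> set (Q i) \<subseteq> S"
    by metis
  \<comment> \<open>This is where a crossing becomes a contradiction: pieces through a common vertex
    trace back to the same entrance arc.\<close>
  have top_meet: "i = j" if ij: "i \<in> L" "j \<in> L"
    and meet: "set (G1.awalk_verts (v i) (P i)) \<inter> set (G1.awalk_verts (v j) (P j)) \<noteq> {}" for i j
  proof -
    have "e' i = e' j"
      using G1.awalks_sharing_vertex_start_eq[of S "e' i" "e' j" "P i" "v (\<tau> i)" "P j" "v (\<tau> j)"]
        inj_h L[OF ij(1)] L[OF ij(2)] \<tau>[OF ij(1)] \<tau>[OF ij(2)] meet by (simp add: ends_eq)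
    then show ?thesis using L[OF ij(1)] L[OF ij(2)] v_eq_iff by metis
  qed
  have bottom_meet: "i = j" if ij: "i \<in> R" "j \<in> R"
    and meet: "set (G2.awalk_verts (w (k + i)) (Q i)) \<inter> set (G2.awalk_verts (w (k + j)) (Q j)) \<noteq> {}" for i j
  proof -
    have "e i = e j"
      using G2.awalks_sharing_vertex_start_eq[of S "e i" "e j" "Q i" "w (k + \<sigma> i)" "Q j" "w (k + \<sigma> j)"]
        inj_h R[OF ij(1)] R[OF ij(2)] \<sigma>[OF ij(1)] \<sigma>[OF ij(2)] meet by (simp add: ends_eq)
    then show ?thesis using R[OF ij(1)] R[OF ij(2)] v_eq_iff by metis
  qed
  have last_in: "y \<in> set (pre_digraph.awalk_verts G x p)" if "wf_digraph G" "pre_digraph.awalk G x p y"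
    for G :: "('a, 'b) pre_digraph" and x y p
    using that wf_digraph.awlast_of_awalk[OF that] pre_digraph.awalk_verts_non_Nil
    by (metis last_in_set wf_digraph.awalkE')
  \<comment> \<open>Pieces with the same exit share their last vertex.\<close>
  have inj_\<tau>: "inj_on \<tau> L"
  proof (rule inj_onI)
    fix i j assume ij: "i \<in> L" "j \<in> L" "\<tau> i = \<tau> j"
    then show "i = j"
      using top_meet[OF ij(1,2)] last_in[OF G1.wf_digraph_axioms \<tau>(2)[OF ij(1)]]
        last_in[OF G1.wf_digraph_axioms \<tau>(2)[OF ij(2)]] by auto
  qed
  have inj_\<sigma>: "inj_on \<sigma> R"
  proof (rule inj_onI)
    fix i j assume ij: "i \<in> R" "j \<in> R" "\<sigma> i = \<sigma> j"
    then show "i = j"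
      using bottom_meet[OF ij(1,2)] last_in[OF G2.wf_digraph_axioms \<sigma>(2)[OF ij(1)]]
        last_in[OF G2.wf_digraph_axioms \<sigma>(2)[OF ij(2)]] by auto
  qed
  have fin: "finite L" "finite R" unfolding L_def R_def by auto
  have sub: "\<tau> ` L \<subseteq> R" "\<sigma> ` R \<subseteq> L" using \<tau>(1) \<sigma>(1) by auto
  have "card L \<le> card R" "card R \<le> card L"
    using card_inj_on_le[OF inj_\<tau> sub(1) fin(2)] card_inj_on_le[OF inj_\<sigma> sub(2) fin(1)] .
  \<comment> \<open>Injections in both directions between finite sets are both onto.\<close>
  then have im_\<tau>: "\<tau> ` L = R" and im_\<sigma>: "\<sigma> ` R = L"
    using card_seteq[OF fin(2) sub(1)] card_seteq[OF fin(1) sub(2)]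
      card_image[OF inj_\<tau>] card_image[OF inj_\<sigma>] by auto
  \<comment> \<open>\<open>\<tau>\<close> is indexed by left ends but \<open>\<sigma>\<close> by
    right ends; for the comparison both must be indexed by right ends.\<close>
  define \<tau>' where "\<tau>' = inv_into L \<tau>"
  have \<tau>': "\<tau>' r \<in> L" "\<tau> (\<tau>' r) = r" if "r \<in> R" for r
    using that im_\<tau> unfolding \<tau>'_def by (auto intro: inv_into_into f_inv_into_f)
  have \<tau>'_\<tau>: "\<tau>' (\<tau> j) = j" if "j \<in> L" for j
    unfolding \<tau>'_def using inj_\<tau> that by (rule inv_into_f_f)
  have le_\<tau>: "j \<le> \<tau> j" if "j \<in> L" for j
  proof (cases "P j = []")
    case True
    then have "v j = v (\<tau> j)" using \<tau>(2)[OF that] by (simp add: G1.awalk_Nil_iff)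
    then show ?thesis using v_eq_iff L(1)[OF that] R(1)[OF \<tau>(1)[OF that]] by simp
  next
    case False
    then show ?thesis
      using v_order[OF L(1)[OF that] R(1)[OF \<tau>(1)[OF that]] G1.awalk_imp_apath[OF \<tau>(2)[OF that]]] by simp
  qed
  have le_\<sigma>: "\<sigma> i \<le> i" if "i \<in> R" for i
  proof (cases "Q i = []")
    case True
    then have "w (k + i) = w (k + \<sigma> i)" using \<sigma>(2)[OF that] by (simp add: G2.awalk_Nil_iff)
    then show ?thesis using w_eq_iff R(1)[OF that] L(1)[OF \<sigma>(1)[OF that]] by simp
  next
    case False
    have "k + i \<in> {k + 1..2 * k}" "k + \<sigma> i \<in> {k + 1..2 * k}"
      using R(1)[OF that] L(1)[OF \<sigma>(1)[OF that]] by auto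
    from w_order[OF this G2.awalk_imp_apath[OF \<sigma>(2)[OF that]] False] show ?thesis by simp
  qed
  \<comment> \<open>The only arc of the cycle leaving \<open>v r\<close> is \<open>e r\<close>,
    which is not in \<open>G1\<close>, so the upper piece starting there is trivial. Below,
    \<open>e' r\<close> plays the same part at \<open>w (k + r)\<close>.\<close>
  have fixed_\<tau>: "\<tau> r = r" if r: "r \<in> L" "r \<in> R" for r
  proof -
    have "P r = []"
    proof (rule ccontr)
      assume "P r \<noteq> []"
      then obtain x p where "P r = x # p" by (cases "P r") auto
      then have x: "x \<in> arcs G1" "tail H x = v r" "x \<in> S"
        using \<tau>[OF r(1)] by (auto simp: G1.awalk_Cons_iff ends_eq)
      then have "x = e r" using R[OF r(2)] by (intro inj_onD[OF inj_t]) auto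
      then show False using x R[OF r(2)] by simp
    qed
    then have "v r = v (\<tau> r)" using \<tau>(2)[OF r(1)] by (simp add: G1.awalk_Nil_iff)
    then show ?thesis using v_eq_iff L(1)[OF r(1)] R(1)[OF \<tau>(1)[OF r(1)]] by simp
  qed
  have fixed_\<sigma>: "\<sigma> r = r" if r: "r \<in> L" "r \<in> R" for r
  proof -
    have "Q r = []"
    proof (rule ccontr)
      assume "Q r \<noteq> []"
      then obtain x p where "Q r = x # p" by (cases "Q r") auto
      then have x: "x \<in> arcs G2" "tail H x = w (k + r)" "x \<in> S"
        using \<sigma>[OF r(2)] by (auto simp: G2.awalk_Cons_iff ends_eq)
      then have "x = e' r" using L[OF r(1)] by (intro inj_onD[OF inj_t]) auto
      then show False using x L[OF r(1)] by simp
    qed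
    then have "w (k + r) = w (k + \<sigma> r)" using \<sigma>(2)[OF r(2)] by (simp add: G2.awalk_Nil_iff)
    then show ?thesis using w_eq_iff R(1)[OF r(2)] L(1)[OF \<sigma>(1)[OF r(2)]] by simp
  qed
  have matching: "\<sigma> r = \<tau>' r" if "r \<in> R" for r
    using _ _ _ _ _ _ _ _ _ that
  proof (rule noncrossing_matching_unique)
    show "inj_on \<sigma> R" by (rule inj_\<sigma>)
    show "inj_on \<tau>' R" using \<tau>' by (metis inj_onI)
    have "\<tau>' ` R = L"
    proof
      show "L \<subseteq> \<tau>' ` R" using \<tau>'_\<tau> \<tau>(1) by (metis image_eqI subsetI)
    qed (use \<tau>' in blast)
    then show "\<sigma> ` R = \<tau>' ` R" using im_\<sigma> by simp
    show "\<sigma> r \<le> r" if "r \<in> R" for r using le_\<sigma> that .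
    show "\<tau>' r \<le> r" if "r \<in> R" for r using le_\<tau>[OF \<tau>'(1)[OF that]] \<tau>'(2)[OF that] by simp
    show "\<sigma> r = r" if "r \<in> R" "r \<in> \<sigma> ` R" for r
      using fixed_\<sigma> that im_\<sigma> by simp
    show "\<tau>' r = r" if "r \<in> R" "r \<in> \<tau>' ` R" for r
      using fixed_\<tau>[of r] \<tau>'_\<tau>[of r] that \<open>\<tau>' ` R = L\<close> by simp
    show False if r: "r \<in> R" "r' \<in> R" and order: "\<sigma> r < \<sigma> r'" "\<sigma> r' < r" "r < r'" for r r'
    proof -
      have "set (G2.awalk_verts (w (k + r)) (Q r)) \<inter> set (G2.awalk_verts (w (k + r')) (Q r')) \<noteq> {}"
        by (rule G2.interlaced_awalks_meet_lower[OF emb2 lower \<sigma>(2)[OF r(1)] \<sigma>(2)[OF r(2)]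
            pos_w[OF R(1)[OF r(1)]] pos_w[OF L(1)[OF \<sigma>(1)[OF r(1)]]]
            pos_w[OF R(1)[OF r(2)]] pos_w[OF L(1)[OF \<sigma>(1)[OF r(2)]]]])
          (use order in auto)
      then show False using bottom_meet[OF r] order by simp
    qed
    show False if r: "r \<in> R" "r' \<in> R" and order: "\<tau>' r < \<tau>' r'" "\<tau>' r' < r" "r < r'" for r r'
    proof -
      let ?i = "\<tau>' r" and ?j = "\<tau>' r'"
      note ij = \<tau>'(1)[OF r(1)] \<tau>'(1)[OF r(2)]
      have "set (G1.awalk_verts (v ?i) (P ?i)) \<inter> set (G1.awalk_verts (v ?j) (P ?j)) \<noteq> {}"
        by (rule G1.interlaced_awalks_meet_upper[OF emb1 upper \<tau>(2)[OF ij(1)] \<tau>(2)[OF ij(2)]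
            pos_v[OF L(1)[OF ij(1)]] pos_v[OF R(1)[OF \<tau>(1)[OF ij(1)]]]
            pos_v[OF L(1)[OF ij(2)]] pos_v[OF R(1)[OF \<tau>(1)[OF ij(2)]]]])
          (use order \<tau>'(2)[OF r(1)] \<tau>'(2)[OF r(2)] in auto)
      then show False using top_meet[OF ij] order by simp
    qed
  qed
  have "L \<noteq> {}"
  proof
    assume "L = {}"
    then have "R = {}" using im_\<tau> by simp
    with \<open>L = {}\<close> show False
      using cycle_contains_connecting_arc[OF cyc] unfolding L_def R_def S_def by blast
  qed
  then obtain j where j: "j \<in> L" by blast
  define i where "i = \<tau> j"
  have i: "i \<in> R" using \<tau>(1)[OF j] by (simp add: i_def)
  have \<sigma>_i: "\<sigma> i = j" using matching[OF i] \<tau>'_\<tau>[OF j] by (simp add: i_def)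
  have walks: "G1.awalk (v j) (P j) (v i)" "G2.awalk (w (k + i)) (Q i) (w (k + j))"
    using \<tau>(2)[OF j] \<sigma>(2)[OF i] \<sigma>_i by (simp_all add: i_def)
  \<comment> \<open>One round trip: up at \<open>j\<close>, across the top to \<open>i\<close>,
    down, and back along the bottom to \<open>j\<close>. It is closed under successors, so it
    exhausts the cycle, and \<open>e' j\<close> is its only upward arc.\<close>
  define T where "T = {e' j, e i} \<union> set (P j) \<union> set (Q i)"
  have T_sub: "T \<subseteq> S" using L[OF j] R[OF i] \<tau>(3)[OF j] \<sigma>(3)[OF i] by (simp add: T_def)
  have "head H ` T \<subseteq> tail H ` T"
    using G1.awalk_heads_subset[OF walks(1)] G2.awalk_heads_subset[OF walks(2)] L[OF j] R[OF i]
    unfolding T_def ends_eq by auto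
  moreover have "inj_on (tail H) (T \<union> set c)" using inj_t T_sub by (simp add: S_def Un_absorb1)
  moreover have "T \<inter> set c \<noteq> {}" using T_sub unfolding T_def S_def by auto
  ultimately have "set c \<subseteq> T" by (intro closed_cycle_subset[OF cc])
  moreover have "a \<notin> e' ` {1..k}" if "a \<in> insert (e i) (set (P j) \<union> set (Q i))" for a
  proof -
    have "set (P j) \<subseteq> arcs G1" "set (Q i) \<subseteq> arcs G2" using walks by auto
    then have "a = e i \<or> a \<in> arcs G1 \<or> a \<in> arcs G2" using that by auto
    then show ?thesis
      unfolding up_iff using arcs_G1 arcs_G2 not_both e_ends distinguished_verts R(1)[OF i] by metis
  qed
  moreover have "e' j \<in> set c" "e' j \<in> e' ` {1..k}" using L[OF j] by (auto simp: S_def)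
  ultimately have "{a \<in> set c. a \<in> e' ` {1..k}} = {e' j}" unfolding T_def by blast
  then show ?thesis by blast
qed

text \<open>Disjoint cycles share no arcs, so the single upward arcs of the cycles add up.\<close>

lemma planar_cycle_system_positive:
  assumes planar: "strongly_planar H G1 G2 k v w" and sys: "cycle_system H \<C>"
  shows "upward_edge_count H G1 G2 \<C> = card \<C>"
proof -
  let ?up = "\<lambda>C. {a \<in> C. a \<in> e' ` {1..k}}"
  have fam: "cycle_family (tail H) (head H) (arcs H) \<C>"
    using sys by (simp add: cycle_system_iff_cycle_family)
  have C_sub: "C \<subseteq> arcs H" if "C \<in> \<C>" for C
    using fam that by (simp add: cycle_family_def)
  have "\<C> \<subseteq> Pow (arcs H)" using C_sub by blast
  then have fin: "finite \<C>" using finite_arcs by (meson finite_Pow_iff finite_subset)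
  have one: "card (?up C) = 1" if "C \<in> \<C>" for C
  proof -
    have "\<forall>C\<in>\<C>. \<exists>c. cycle c \<and> C = set c" using sys by (simp add: cycle_system_def)
    then have "\<exists>c. cycle c \<and> C = set c" using that by (rule bspec)
    then obtain c where c: "cycle c" "C = set c" by blast
    then obtain a where "?up C = {a}" using unique_up_arc[OF planar c(1)] by auto
    then show ?thesis by simp
  qed
  have disj: "?up C \<inter> ?up D = {}" if "C \<in> \<C>" "D \<in> \<C>" "C \<noteq> D" for C D
  proof -
    have "tail H ` C \<inter> tail H ` D = {}" using sys that by (simp add: cycle_system_def)
    then show ?thesis by blast
  qed
  have "{a \<in> \<Union>\<C>. tail H a \<in> verts G2 \<and> head H a \<in> verts G1} = (\<Union>C\<in>\<C>. ?up C)"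
    unfolding up_iff using C_sub by blast
  then have "upward_edge_count H G1 G2 \<C> = card (\<Union>C\<in>\<C>. ?up C)"
    by (simp add: upward_edge_count_def)
  also have "\<dots> = (\<Sum>C\<in>\<C>. card (?up C))"
  proof (rule card_UN_disjoint)
    show "\<forall>C\<in>\<C>. finite (?up C)"
      using one by (metis card.infinite zero_neq_one)
  qed (use fin disj in auto)
  also have "\<dots> = card \<C>" using one by simp
  finally show ?thesis .
qed

end

theorem corollary1p2:
  fixes H G1 G2 :: "('a, 'b) pre_digraph"
    and k :: nat
    and v w :: "nat \<Rightarrow> 'a"
    and e e' :: "nat \<Rightarrow> 'b"
  assumes "hamburger_graph H G1 G2 k v w e e'"
    and "strongly_planar H G1 G2 k v w"
  shows "Determinant.det (hamburger_matrix G1 G2 k v w)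
    = int (card {\<C>. positive_cycle_system H G1 G2 \<C>})"
proof -
  interpret hamburger_graph H G1 G2 k v w e e' by (rule assms(1))
  have sign: "(- 1 :: int) ^ (upward_edge_count H G1 G2 \<C> + card \<C>) = 1" if "cycle_system H \<C>" for \<C>
    using planar_cycle_system_positive[OF assms(2) that] by simp
  then have "{\<C>. positive_cycle_system H G1 G2 \<C>} = {\<C>. cycle_system H \<C>}"
    by (auto simp: positive_cycle_system_def)
  then show ?thesis
    unfolding det_hamburger_matrix using sign by simp
qed

end
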